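(* Let $E$ be a Banach space and $(\alpha_t)_{t\in\mathbb R}$ a one-parameter group of isometries on $E$, and suppose either that $(\alpha_t)$ is norm-continuous, or that $E=(E_* )^*$ is a dual Banach space and $(\alpha_t)$ is weak$^*$-continuous. Let $D\subseteq E$ be an $(\alpha_t)$-invariant subspace, let $z\in\mathbb C$, and suppose that $D\subseteq D(\alpha_z)$. If $D$ is dense in $E$ (in norm in the norm-continuous case, weak$^*$ in the weak$^*$-continuous case), then $D$ is a core for $\alpha_z$.
   Context: A one-parameter group of isometries on a Banach space $E$ is a family $(\alpha_t)_{t\in\mathbb R}$ of contractive linear operators with $\alpha_0=\mathrm{id}$ and $\alpha_t\circ\alpha_s=\alpha_{t+s}$; it is norm-continuous if $t\mapsto\alpha_t(x)$ is norm continuous for each $x$. If $E=(E_* )^*$ is a dual Banach space, it is weak$^*$-continuous if each $\alpha_t$ is weak$^*$-continuous and each orbit map $t\mapsto\alpha_t(x)$ is weak$^*$-continuous. A subspace $D$ is $(\alpha_t)$-invariant if $\alpha_t(x)\in D$ for each $x\in D$, $t\in\mathbb R$. For $z\in\mathbb C\setminus\mathbb R$ let $S(z)=\{w\in\mathbb C: 0\le \operatorname{Im} w/\operatorname{Im} z\le 1\}$; for $z\in\mathbb R$ let $S(z)=\mathbb R$. A map $f:S(z)\to E$ is norm-regular (weak$^*$-regular) if it is norm (weak$^*$) continuous, and analytic in the interior of $S(z)$. For a norm-continuous (respectively weak$^*$-continuous) group, $D(\alpha_z)$ is the set of $x\in E$ for which there is a norm-regular (respectively weak$^*$-regular) $f:S(z)\to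 E$ with $f(t)=\alpha_t(x)$ for all $t\in\mathbb R$; such $f$ is unique, and $\alpha_z(x)=f(z)$. $D$ is a core for $\alpha_z$ means that $\{(x,\alpha_z(x)):x\in D\}$ is dense in the graph $\mathcal G(\alpha_z)=\{(x,\alpha_z(x)):x\in D(\alpha_z)\}\subseteq E\oplus E$, for the norm topology in the norm-continuous case, and for the weak$^*$-topology (from the predual $E_*\oplus E_*$) in the weak$^*$-continuous case. *)

theory Defs
  imports "HOL-Analysis.Analysis"
begin

text \<open>The real scalar multiplication inherited from \<^class>\<open>banach\<close> is required to be the
  restriction of the complex one.\<close>

class complex_banach = banach +
  fixes scaleC :: "complex \<Rightarrow> 'a \<Rightarrow> 'a"  (infixr "*\<^sub>C" 75)
  assumes scaleC_add_right: "a *\<^sub>C (x + y) = a *\<^sub>C x + a *\<^sub>C y"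
    and scaleC_add_left: "(a + b) *\<^sub>C x = a *\<^sub>C x + b *\<^sub>C x"
    and scaleC_scaleC: "a *\<^sub>C b *\<^sub>C x = (a * b) *\<^sub>C x"
    and scaleC_of_real: "complex_of_real r *\<^sub>C x = r *\<^sub>R x"
    and norm_scaleC: "norm (a *\<^sub>C x) = cmod a * norm x"

instantiation complex :: complex_banach
begin

definition scaleC_complex :: "complex \<Rightarrow> complex \<Rightarrow> complex"
  where "scaleC_complex a x = a * x"

instance
  by standard (simp_all add: scaleC_complex_def algebra_simps norm_mult scaleR_conv_of_real)

end

definition csubspace :: "'e::complex_banach set \<Rightarrow> bool"
  where "csubspace D \<longleftrightarrow>
    0 \<in> D \<and> (\<forall>x\<in>D. \<forall>y\<in>D. x + y \<in> D) \<and> (\<forall>c. \<forall>x\<in>D. c *\<^sub>C x \<in> D)"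

definition clinear :: "('e::complex_banach \<Rightarrow> 'f::complex_banach) \<Rightarrow> bool"
  where "clinear T \<longleftrightarrow>
    (\<forall>x y. T (x + y) = T x + T y) \<and> (\<forall>c x. T (c *\<^sub>C x) = c *\<^sub>C T x)"

definition cdual :: "('p::complex_banach \<Rightarrow> complex) set"
  where "cdual = {\<phi>. clinear \<phi> \<and> bounded_linear \<phi>}"

text \<open>\<open>is_predual B\<close> says that \<open>'e\<close> is the dual Banach space of \<open>'p\<close>, the identification being
  the isometric isomorphism \<open>x \<mapsto> B x\<close> of \<open>'e\<close> onto the space of bounded functionals on \<open>'p\<close>;
  \<open>B x p\<close> is the value of \<open>x\<close> at \<open>p\<close>.\<close>

definition is_predual :: "('e::complex_banach \<Rightarrow> 'p::complex_banach \<Rightarrow> complex) \<Rightarrow> bool"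
  where "is_predual B \<longleftrightarrow>
    bij_betw B UNIV cdual \<and> (\<forall>p. clinear (\<lambda>x. B x p)) \<and> (\<forall>x. onorm (B x) = norm x)"

definition weak_star :: "('e \<Rightarrow> 'p \<Rightarrow> complex) \<Rightarrow> 'e topology"
  where "weak_star B = topology_generated_by {{x. B x p \<in> U} | p U. open U}"

text \<open>The pairing of \<open>E \<oplus> E\<close> with its predual \<open>E\<^sub>* \<oplus> E\<^sub>*\<close>.\<close>

definition sum_pairing :: "('e \<Rightarrow> 'p \<Rightarrow> complex) \<Rightarrow> 'e \<times> 'e \<Rightarrow> 'p \<times> 'p \<Rightarrow> complex"
  where "sum_pairing B = (\<lambda>(x, y) (p, q). B x p + B y q)"

definition isometry_group :: "(real \<Rightarrow> 'e::complex_banach \<Rightarrow> 'e) \<Rightarrow> bool"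
  where "isometry_group \<alpha> \<longleftrightarrow>
    (\<forall>t. clinear (\<alpha> t) \<and> (\<forall>x. norm (\<alpha> t x) \<le> norm x)) \<and>
    \<alpha> 0 = id \<and> (\<forall>t s. \<alpha> t \<circ> \<alpha> s = \<alpha> (t + s))"

definition norm_continuous_group :: "(real \<Rightarrow> 'e::complex_banach \<Rightarrow> 'e) \<Rightarrow> bool"
  where "norm_continuous_group \<alpha> \<longleftrightarrow> (\<forall>x. continuous_on UNIV (\<lambda>t. \<alpha> t x))"

definition weak_star_continuous_group ::
    "('e::complex_banach \<Rightarrow> 'p::complex_banach \<Rightarrow> complex) \<Rightarrow> (real \<Rightarrow> 'e \<Rightarrow> 'e) \<Rightarrow> bool"
  where "weak_star_continuous_group B \<alpha> \<longleftrightarrow>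
    (\<forall>t. continuous_map (weak_star B) (weak_star B) (\<alpha> t)) \<and>
    (\<forall>x. continuous_map euclidean (weak_star B) (\<lambda>t. \<alpha> t x))"

definition group_invariant :: "(real \<Rightarrow> 'e \<Rightarrow> 'e) \<Rightarrow> 'e set \<Rightarrow> bool"
  where "group_invariant \<alpha> D \<longleftrightarrow> (\<forall>x\<in>D. \<forall>t. \<alpha> t x \<in> D)"

definition strip :: "complex \<Rightarrow> complex set"
  where "strip z = (if z \<in> \<real> then \<real> else {w. 0 \<le> Im w / Im z \<and> Im w / Im z \<le> 1})"

text \<open>Complex differentiability in norm at every point of an open set, for Banach space valued
  functions; the library's \<^const>\<open>holomorphic_on\<close> only covers complex values.\<close>

definition analytic_on_open :: "(complex \<Rightarrow> 'e::complex_banach) \<Rightarrow> complex set \<Rightarrow> bool"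
  where "analytic_on_open f U \<longleftrightarrow>
    (\<forall>w\<in>U. \<exists>d. (f has_derivative (\<lambda>h. h *\<^sub>C d)) (at w))"

text \<open>Below, \<open>T\<close> is the topology on \<open>E\<close>: \<^term>\<open>euclidean\<close> (the norm topology) in the
  norm-continuous case, \<^term>\<open>weak_star B\<close> in the weak-star continuous case.  It only affects
  continuity on the strip; analyticity in the interior is meant in norm in both cases.\<close>

definition regular_on_strip ::
    "'e::complex_banach topology \<Rightarrow> complex \<Rightarrow> (complex \<Rightarrow> 'e) \<Rightarrow> bool"
  where "regular_on_strip T z f \<longleftrightarrow>
    continuous_map (top_of_set (strip z)) T f \<and> analytic_on_open f (interior (strip z))"

definition is_extension ::
    "'e::complex_banach topology \<Rightarrow> (real \<Rightarrow> 'e \<Rightarrow> 'e) \<Rightarrow> complex \<Rightarrow> 'e \<Rightarrow> (complex \<Rightarrow> 'e) \<Rightarrow> bool"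
  where "is_extension T \<alpha> z x f \<longleftrightarrow>
    regular_on_strip T z f \<and> (\<forall>t. f (complex_of_real t) = \<alpha> t x)"

definition ext_dom ::
    "'e::complex_banach topology \<Rightarrow> (real \<Rightarrow> 'e \<Rightarrow> 'e) \<Rightarrow> complex \<Rightarrow> 'e set"
  where "ext_dom T \<alpha> z = {x. \<exists>f. is_extension T \<alpha> z x f}"

definition group_ext ::
    "'e::complex_banach topology \<Rightarrow> (real \<Rightarrow> 'e \<Rightarrow> 'e) \<Rightarrow> complex \<Rightarrow> 'e \<Rightarrow> 'e"
  where "group_ext T \<alpha> z x = (THE y. \<exists>f. is_extension T \<alpha> z x f \<and> f z = y)"

definition ext_graph ::
    "'e::complex_banach topology \<Rightarrow> (real \<Rightarrow> 'e \<Rightarrow> 'e) \<Rightarrow> complex \<Rightarrow> ('e \<times> 'e) set"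
  where "ext_graph T \<alpha> z = {(x, group_ext T \<alpha> z x) | x. x \<in> ext_dom T \<alpha> z}"

text \<open>\<open>T2\<close> is the topology on \<open>E \<oplus> E\<close> in which density is measured.\<close>

definition is_core ::
    "'e::complex_banach topology \<Rightarrow> ('e \<times> 'e) topology \<Rightarrow> (real \<Rightarrow> 'e \<Rightarrow> 'e) \<Rightarrow> complex \<Rightarrow> 'e set \<Rightarrow> bool"
  where "is_core T T2 \<alpha> z D \<longleftrightarrow>
    D \<subseteq> ext_dom T \<alpha> z \<and>
    ext_graph T \<alpha> z \<subseteq> T2 closure_of {(x, group_ext T \<alpha> z x) | x. x \<in> D}"

end

theory Submission
  imports Defs "HOL-Complex_Analysis.Complex_Analysis" "HOL-Probability.Sinc_Integral"
begin

text \<open>By Hahn--Banach it suffices to show that a pair \<open>(\<phi>, \<psi>)\<close> of functionals with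
  \<open>\<phi> y + \<psi> (\<alpha>\<^sub>z y) = 0\<close> on \<open>D\<close> satisfies this on all of \<open>D(\<alpha>\<^sub>z)\<close>. Smear both functionals with a
  Gaussian \<open>k\<close> of width \<open>1/n\<close>: \<open>\<psi>\<^sub>n x = \<integral> k t * \<psi> (\<alpha>\<^sub>t x) dt\<close>. The function \<open>w \<mapsto> \<psi>\<^sub>n (\<alpha>\<^sub>w x)\<close> agrees on the
  real line, hence on the strip, with the entire function \<open>w \<mapsto> \<integral> k (t - w) * \<psi> (\<alpha>\<^sub>t x) dt\<close>; thus
  \<open>\<psi>\<^sub>n \<circ> \<alpha>\<^sub>z\<close> extends to an everywhere defined continuous functional. Since \<open>D\<close> is invariant, the
  smeared identity still holds on \<open>D\<close>, by density it holds on \<open>E\<close>, and \<open>n \<rightarrow> \<infinity>\<close> gives the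
  claim. In the weak-star case the smeared functionals remain in the predual because the preadjoint
  group, being weakly continuous, is norm continuous.\<close>

subsection \<open>Hahn--Banach for complex Banach spaces\<close>

text \<open>Smearing the vectors of \<open>D\<close> instead of the functionals would fail:
  \<open>D\<close> is not assumed closed, so it need not contain integrals of its own orbits. An
  annihilator relation does survive integration, since by invariance it holds at every
  \<open>\<alpha> t y\<close> as soon as it holds on \<open>D\<close>; this is why the argument is
  carried out on the dual side. The Gaussian is chosen because it is entire and all its complex
  translates are still integrable: the group law moves a translation of the orbit onto the kernel,
  and the kernel can be translated by a complex number. The functional tested on \<open>D\<close>
  smears \<phi> with the unshifted kernel and \<psi> with the kernel shifted by z, so
  \<open>group_ext\<close> no longer occurs in it and density can be applied. No complex analysis of
  vector-valued functions is used: every identity between extensions is tested against a separating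
  family of functionals, which reduces it to scalar functions on the strip.\<close>

definition sublinear :: "('a::real_vector \<Rightarrow> real) \<Rightarrow> bool"
  where "sublinear s \<longleftrightarrow> (\<forall>x y. s (x + y) \<le> s x + s y) \<and> (\<forall>r x. 0 \<le> r \<longrightarrow> s (r *\<^sub>R x) = r * s x)"

text \<open>The inequality for \<open>inverse r\<close> at \<open>r *\<^sub>R x\<close> is the
  reverse of the inequality for r at x, so one direction for positive r already gives
  homogeneity.\<close>

lemma sublinearI:
  assumes "\<And>x y. s (x + y) \<le> s x + s y" "\<And>r x. 0 < r \<Longrightarrow> s (r *\<^sub>R x) \<le> r * s x" "s 0 = 0"
  shows "sublinear s"
  unfolding sublinear_def
proof (intro conjI allI impI)
  fix r :: real and x :: 'a assume r: "0 \<le> r"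
  show "s (r *\<^sub>R x) = r * s x"
  proof (cases "r = 0")
    case False
    then have r: "0 < r" using r by simp
    have "s (inverse r *\<^sub>R (r *\<^sub>R x)) \<le> inverse r * s (r *\<^sub>R x)"
      using assms(2)[of "inverse r" "r *\<^sub>R x"] r by simp
    then have "r * s x \<le> s (r *\<^sub>R x)" using r by (simp add: field_simps)
    then show ?thesis using assms(2)[OF r, of x] by simp
  qed (simp add: assms)
qed (rule assms)

lemma sublinear_add: "sublinear s \<Longrightarrow> s (x + y) \<le> s x + s y"
  and sublinear_scaleR: "sublinear s \<Longrightarrow> 0 \<le> r \<Longrightarrow> s (r *\<^sub>R x) = r * s x"
  by (simp_all add: sublinear_def)

lemma sublinear_0: "sublinear s \<Longrightarrow> s 0 = 0"
  using sublinear_scaleR[of s 0 0] by simp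

lemma sublinear_neg: "sublinear s \<Longrightarrow> - s (- x) \<le> s x"
  using sublinear_add[of s x "-x"] sublinear_0[of s] by simp

text \<open>The largest sublinear functional below \<open>g\<close> whose value at \<open>- y\<close> is at most \<open>- g y\<close>.\<close>

definition shrink :: "('a::real_vector \<Rightarrow> real) \<Rightarrow> 'a \<Rightarrow> 'a \<Rightarrow> real"
  where "shrink g y x = (INF t\<in>{0..}. g (x + t *\<^sub>R y) - t * g y)"

lemma shrink_bdd:
  assumes "sublinear g" shows "bdd_below ((\<lambda>t. g (x + t *\<^sub>R y) - t * g y) ` {0..})"
proof (rule bdd_belowI2)
  fix t :: real assume "t \<in> {0..}"
  then have "t * g y = g ((x + t *\<^sub>R y) + (- x))" using assms by (simp add: sublinear_scaleR)
  also have "\<dots> \<le> g (x + t *\<^sub>R y) + g (- x)" by (rule sublinear_add[OF assms])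
  finally show "- g (- x) \<le> g (x + t *\<^sub>R y) - t * g y" by simp
qed

lemma shrink_le:
  assumes "sublinear g" "0 \<le> t" shows "shrink g y x \<le> g (x + t *\<^sub>R y) - t * g y"
  unfolding shrink_def using assms(2) by (intro cINF_lower shrink_bdd[OF assms(1)]) auto

text \<open>Each infimum on the right is bounded one parameter at a time: parameters t1 and t2 for
  the summands give the parameter t1 + t2 for the sum, and t for x gives r * t for the
  multiple.\<close>

lemma shrink_sublinear:
  assumes g: "sublinear g" shows "sublinear (shrink g y)"
proof (rule sublinearI)
  fix x1 x2
  have "shrink g y (x1 + x2) - (g (x2 + t2 *\<^sub>R y) - t2 * g y) \<le> shrink g y x1" if "t2 \<ge> 0" for t2
    unfolding shrink_def[of g y x1]
  proof (rule cINF_greatest)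
    fix t1 :: real assume "t1 \<in> {0..}"
    then have "shrink g y (x1 + x2) \<le> g ((x1 + x2) + (t1 + t2) *\<^sub>R y) - (t1 + t2) * g y"
      using that by (intro shrink_le g) auto
    also have "g ((x1 + x2) + (t1 + t2) *\<^sub>R y) \<le> g (x1 + t1 *\<^sub>R y) + g (x2 + t2 *\<^sub>R y)"
      using sublinear_add[OF g, of "x1 + t1 *\<^sub>R y" "x2 + t2 *\<^sub>R y"] by (simp add: algebra_simps)
    finally show "shrink g y (x1 + x2) - (g (x2 + t2 *\<^sub>R y) - t2 * g y) \<le> g (x1 + t1 *\<^sub>R y) - t1 * g y"
      by (simp add: algebra_simps)
  qed simp
  then have "shrink g y (x1 + x2) - shrink g y x1 \<le> g (x2 + t2 *\<^sub>R y) - t2 * g y" if "t2 \<ge> 0" for t2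
    using that by (simp add: algebra_simps)
  then have "shrink g y (x1 + x2) - shrink g y x1 \<le> shrink g y x2"
    unfolding shrink_def[of g y x2] by (intro cINF_greatest) auto
  then show "shrink g y (x1 + x2) \<le> shrink g y x1 + shrink g y x2" by simp
next
  fix r :: real and x assume r: "0 < r"
  have "shrink g y (r *\<^sub>R x) / r \<le> shrink g y x"
    unfolding shrink_def[of g y x]
  proof (rule cINF_greatest)
    fix t :: real assume "t \<in> {0..}"
    then have "shrink g y (r *\<^sub>R x) \<le> g (r *\<^sub>R x + (r * t) *\<^sub>R y) - (r * t) * g y"
      using r by (intro shrink_le g) auto
    also have "g (r *\<^sub>R x + (r * t) *\<^sub>R y) = r * g (x + t *\<^sub>R y)"
      using sublinear_scaleR[OF g, of r "x + t *\<^sub>R y"] r by (simp add: algebra_simps)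
    finally show "shrink g y (r *\<^sub>R x) / r \<le> g (x + t *\<^sub>R y) - t * g y"
      using r by (simp add: field_simps)
  qed simp
  then show "shrink g y (r *\<^sub>R x) \<le> r * shrink g y x" using r by (simp add: field_simps)
next
  have "(\<lambda>t. g (0 + t *\<^sub>R y) - t * g y) ` {0..} = (\<lambda>t::real. 0) ` {0..}"
    by (rule image_cong[OF refl]) (use g in \<open>simp add: sublinear_scaleR\<close>)
  also have "\<dots> = {0}" by (rule image_constant[of 0]) simp
  finally have "(\<lambda>t. g (0 + t *\<^sub>R y) - t * g y) ` {0..} = {0}" .
  then show "shrink g y 0 = 0" unfolding shrink_def by simp
qed

lemma sublinear_minimal:
  assumes s: "sublinear s"
  obtains g where "sublinear g" "g \<le> s" "\<And>h. sublinear h \<Longrightarrow> h \<le> g \<Longrightarrow> h = g"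
proof -
  define S where "S = {g. sublinear g \<and> g \<le> s}"
  have "\<exists>m\<in>S. \<forall>a\<in>S. a \<le> m \<longrightarrow> a = m"
  \<comment> \<open>The order is reversed, so that the maximal element delivered by Zorn is a
    minimal functional and upper bounds of chains are pointwise infima.\<close>
  proof (rule predicate_Zorn)
    show "partial_order_on S (relation_of (\<lambda>a b. b \<le> a) S)"
      by (rule partial_order_on_relation_ofI) auto
  next
    fix C assume C: "C \<in> Chains (relation_of (\<lambda>a b. b \<le> a) S)"
    then have CS: "C \<subseteq> S" and tot: "\<And>a b. a \<in> C \<Longrightarrow> b \<in> C \<Longrightarrow> a \<le> b \<or> b \<le> a"
      by (auto simp: Chains_def relation_of_def)
    show "\<exists>u\<in>S. \<forall>a\<in>C. u \<le> a"
    proof (cases "C = {}")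
      case True
      then show ?thesis using s by (auto simp: S_def)
    next
      case False
      define u where "u x = (INF h\<in>C. h x)" for x
      have sub: "sublinear h" "h x \<le> s x" if "h \<in> C" for h x
        using that CS by (auto simp: S_def le_fun_def)
      \<comment> \<open>All members h of the chain share the lower bound - s (- x), because - s (-
        x) \<le> - h (- x) \<le> h x.\<close>
      have bdd: "bdd_below ((\<lambda>h. h x) ` C)" for x
      proof (rule bdd_belowI2)
        fix h assume "h \<in> C"
        then show "- s (- x) \<le> h x" using sublinear_neg[of h x] sub(1)[of h] sub(2)[of h "-x"] by linarith
      qed
      have ule: "u x \<le> h x" if "h \<in> C" for h x
        unfolding u_def by (rule cINF_lower[OF bdd that])
      have "sublinear u"
      proof (rule sublinearI)
        fix x y
        have "u (x + y) - h2 y \<le> u x" if h2: "h2 \<in> C" for h2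
          unfolding u_def[of x]
        proof (rule cINF_greatest[OF False])
          fix h1 assume h1: "h1 \<in> C"
          \<comment> \<open>The infima for x and for y may be approached by different members; the
            smaller of the two serves for both.\<close>
          obtain h where h: "h \<in> C" "h \<le> h1" "h \<le> h2" using tot[OF h1 h2] h1 h2 by blast
          have "u (x + y) \<le> h (x + y)" using h by (intro ule)
          also have "\<dots> \<le> h x + h y" using h by (intro sublinear_add sub)
          also have "\<dots> \<le> h1 x + h2 y" using h by (intro add_mono) (auto simp: le_fun_def)
          finally show "u (x + y) - h2 y \<le> h1 x" by simp
        qed
        then have "u (x + y) - u x \<le> u y"
          unfolding u_def[of y] by (intro cINF_greatest[OF False]) (simp add: algebra_simps)
        then show "u (x + y) \<le> u x + u y" by simp
      next
        fix r :: real and x assume r: "0 < r"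
        have "u (r *\<^sub>R x) / r \<le> u x"
          unfolding u_def[of x]
        proof (rule cINF_greatest[OF False])
          fix h assume h: "h \<in> C"
          have "u (r *\<^sub>R x) \<le> r * h x"
            using ule[OF h, of "r *\<^sub>R x"] sublinear_scaleR[OF sub(1)[OF h], of r x] r by simp
          then show "u (r *\<^sub>R x) / r \<le> h x" using r by (simp add: field_simps)
        qed
        then show "u (r *\<^sub>R x) \<le> r * u x" using r by (simp add: field_simps)
      next
        have "(\<lambda>h. h 0) ` C = {0}" using False sub(1) sublinear_0 by fastforce
        then show "u 0 = 0" unfolding u_def by simp
      qed
      moreover obtain h where "h \<in> C" using False by blast
      then have "u \<le> s" using ule[of h] sub(2)[of h] by (auto simp: le_fun_def intro: order_trans)
      ultimately show ?thesis using ule by (auto simp: S_def le_fun_def)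
    qed
  qed
  then show ?thesis using that unfolding S_def by (auto intro: order_trans)
qed

text \<open>A minimal sublinear g is linear: \<open>shrink g y\<close> is sublinear and below g,
  hence equal to g, and its bound at t = 1 is superadditivity. Starting from
  \<open>shrink s p\<close> instead of s forces g (- p) \<le> - s p, which makes the bound sharp at
  p.\<close>

lemma hahn_banach_sublinear:
  assumes s: "sublinear s"
  obtains u where "linear u" "\<And>x. u x \<le> s x" "u p = s p"
proof -
  obtain g where g: "sublinear g" "g \<le> shrink s p" and min: "\<And>h. sublinear h \<Longrightarrow> h \<le> g \<Longrightarrow> h = g"
    using sublinear_minimal[OF shrink_sublinear[OF s, of p]] by metis
  have add: "g (x + y) = g x + g y" for x y
  proof -
    have "shrink g y = g"
    proof (rule min[OF shrink_sublinear[OF g(1)]])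
      show "shrink g y \<le> g" using shrink_le[OF g(1), of 0 y] by (simp add: le_fun_def)
    qed
    then have "g x \<le> g (x + y) - g y" using shrink_le[OF g(1), of 1 y x] by simp
    then show ?thesis using sublinear_add[OF g(1), of x y] by simp
  qed
  have neg: "g (- x) = - g x" for x
    using add[of x "- x"] sublinear_0[OF g(1)] by simp
  have scale: "g (r *\<^sub>R x) = r * g x" for r x
  proof (cases "0 \<le> r")
    case False
    then have "g ((- r) *\<^sub>R (- x)) = (- r) * g (- x)" by (intro sublinear_scaleR g) auto
    then show ?thesis by (simp add: neg)
  qed (simp add: sublinear_scaleR g)
  have gs: "g x \<le> s x" for x
    using g(2) shrink_le[OF s, of 0 p x] by (auto simp: le_fun_def intro: order_trans)
  have "g (- p) \<le> - s p"
    using g(2) shrink_le[OF s, of 1 p "-p"] sublinear_0[OF s] by (auto simp: le_fun_def intro: order_trans)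
  then have "g p = s p" using gs[of p] by (simp add: neg)
  moreover have "linear g" by (rule linearI) (auto simp: add scale)
  ultimately show ?thesis using that gs by blast
qed

section \<open>Complex-linear functionals: extension, norming and separation\<close>

lemma clinear_add: "clinear T \<Longrightarrow> T (x + y) = T x + T y"
  and clinear_scaleC: "clinear T \<Longrightarrow> T (c *\<^sub>C x) = c *\<^sub>C T x"
  by (simp_all add: clinear_def)

lemma clinear_scaleR: "clinear T \<Longrightarrow> T (r *\<^sub>R x) = r *\<^sub>R T x"
  by (metis clinear_scaleC scaleC_of_real)

lemma clinear_imp_linear: "clinear T \<Longrightarrow> linear T"
  by (rule linearI) (simp_all add: clinear_add clinear_scaleR)

lemma clinear_0: "clinear T \<Longrightarrow> T 0 = 0"
  and clinear_diff: "clinear T \<Longrightarrow> T (x - y) = T x - T y"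
  and clinear_minus: "clinear T \<Longrightarrow> T (- x) = - T x"
  by (simp_all add: clinear_imp_linear linear_0 linear_diff linear_neg)

lemma bounded_linear_clinearI: "clinear T \<Longrightarrow> (\<And>x. norm (T x) \<le> norm x * K) \<Longrightarrow> bounded_linear T"
  by (intro bounded_linear_intro) (auto simp: clinear_add clinear_scaleR)

text \<open>The real functional u is complexified as u x - i u (i x). Since s is only
  real-homogeneous, the domination is kept for the real part alone; the bound s \<le> norm gives
  boundedness, for which the crude constant 2 is enough.\<close>

lemma hahn_banach_complex:
  fixes s :: "'a::complex_banach \<Rightarrow> real"
  assumes s: "sublinear s" and le: "\<And>x. s x \<le> norm x"
  obtains \<phi> where "\<phi> \<in> cdual" "\<And>x. Re (\<phi> x) \<le> s x" "Re (\<phi> p) = s p"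
proof -
  obtain u where u: "linear u" "\<And>x. u x \<le> s x" "u p = s p"
    using hahn_banach_sublinear[OF s] by metis
  define \<phi> where "\<phi> x = Complex (u x) (- u (\<i> *\<^sub>C x))" for x
  have decomp: "c *\<^sub>C x = Re c *\<^sub>R x + Im c *\<^sub>R (\<i> *\<^sub>C x)" for c and x :: 'a
  proof -
    have "c = complex_of_real (Re c) + complex_of_real (Im c) * \<i>" by (simp add: complex_eq_iff)
    then have "c *\<^sub>C x = (complex_of_real (Re c) + complex_of_real (Im c) * \<i>) *\<^sub>C x"
      by (rule arg_cong[where f = "\<lambda>a. a *\<^sub>C x"])
    then show ?thesis by (simp only: scaleC_add_left scaleC_of_real scaleC_scaleC[symmetric])
  qed
  have ii: "\<i> *\<^sub>C \<i> *\<^sub>C x = - x" for x :: 'a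
    using scaleC_of_real[of "-1" x] by (simp add: scaleC_scaleC)
  have "\<phi> (c *\<^sub>C x) = c * \<phi> x" for c x
  proof -
    have 1: "u (c *\<^sub>C x) = Re c * u x + Im c * u (\<i> *\<^sub>C x)" for c x
      by (subst decomp) (simp add: linear_add linear_scale u)
    have "\<i> *\<^sub>C c *\<^sub>C x = c *\<^sub>C \<i> *\<^sub>C x" by (simp add: scaleC_scaleC mult.commute)
    then have "u (\<i> *\<^sub>C c *\<^sub>C x) = Re c * u (\<i> *\<^sub>C x) - Im c * u x"
      using 1[of c "\<i> *\<^sub>C x"] by (simp add: ii linear_neg u)
    then show ?thesis using 1[of c x] by (simp add: \<phi>_def complex_eq_iff)
  qed
  moreover have "\<phi> (x + y) = \<phi> x + \<phi> y" for x y
    by (simp add: \<phi>_def scaleC_add_right linear_add u complex_eq_iff)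
  ultimately have cl: "clinear \<phi>" by (simp add: clinear_def scaleC_complex_def)
  have "\<bar>u x\<bar> \<le> norm x" for x
    using u(2)[of x] u(2)[of "-x"] le[of x] le[of "-x"] linear_neg[OF u(1), of x] by simp
  then have "\<bar>u x\<bar> + \<bar>u (\<i> *\<^sub>C x)\<bar> \<le> norm x + norm (\<i> *\<^sub>C x)" for x by (intro add_mono)
  then have "norm (\<phi> x) \<le> norm x + norm (\<i> *\<^sub>C x)" for x
    using order_trans[OF cmod_le[of "\<phi> x"]] by (simp only: \<phi>_def complex.sel abs_minus_cancel)
  then have "norm (\<phi> x) \<le> norm x * 2" for x by (simp add: norm_scaleC mult.commute)
  then have "\<phi> \<in> cdual" using bounded_linear_clinearI[OF cl] cl by (auto simp: cdual_def)
  then show ?thesis using that u by (simp add: \<phi>_def)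
qed

lemma sublinear_norm: "sublinear (norm :: 'a::real_normed_vector \<Rightarrow> real)"
  by (rule sublinearI) (auto simp: norm_triangle_ineq)

lemma cdual_norming:
  fixes p :: "'a::complex_banach"
  obtains \<phi> where "\<phi> \<in> cdual" "\<And>x. norm (\<phi> x) \<le> norm x" "\<phi> p = norm p"
proof -
  obtain \<phi> where \<phi>: "\<phi> \<in> cdual" "\<And>x. Re (\<phi> x) \<le> norm x" "Re (\<phi> p) = norm p"
    using hahn_banach_complex[OF sublinear_norm] by (metis order_refl)
  have le: "norm (\<phi> x) \<le> norm x" for x
  proof -
    \<comment> \<open>Rotating the argument by a unimodular c makes the value real and nonnegative,
      so the bound on the real part becomes one on the modulus.\<close>
    obtain c where c: "norm c = 1" "c * \<phi> x = norm (\<phi> x)"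
    proof (cases "\<phi> x = 0")
      case False
      show ?thesis
      proof (rule that)
        show "norm (cnj (sgn (\<phi> x))) = 1" using False by (simp add: norm_sgn)
        show "cnj (sgn (\<phi> x)) * \<phi> x = norm (\<phi> x)"
          using False by (simp add: sgn_eq complex_norm_square[symmetric] power2_eq_square mult.commute)
      qed
    qed (use that[of 1] in auto)
    have "\<phi> (c *\<^sub>C x) = c * \<phi> x" using \<phi>(1) by (simp add: cdual_def clinear_def scaleC_complex_def)
    then have "norm (\<phi> x) = Re (\<phi> (c *\<^sub>C x))" using c by simp
    also have "\<dots> \<le> norm (c *\<^sub>C x)" by (rule \<phi>)
    finally show ?thesis using c by (simp add: norm_scaleC)
  qed
  \<comment> \<open>The real part already exhausts the allowed modulus, so the imaginary part is
    0.\<close>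
  have "\<phi> p = norm p"
  proof -
    have "(Re (\<phi> p))\<^sup>2 + (Im (\<phi> p))\<^sup>2 \<le> (norm p)\<^sup>2"
      using power_mono[OF le[of p], of 2] by (simp add: cmod_power2)
    then show ?thesis using \<phi>(3) by (simp add: complex_eq_iff)
  qed
  then show ?thesis using that \<phi>(1) le by blast
qed

text \<open>Hahn-Banach is applied to the distance from S, which is sublinear, dominated by the
  norm, zero on S and positive at p. Only real parts are controlled because S is a real subspace;
  this form is applied later to a real span.\<close>

lemma cdual_separates_closed_subspace:
  fixes S :: "'a::complex_banach set"
  assumes "subspace S" "p \<notin> closure S"
  obtains \<phi> where "\<phi> \<in> cdual" "\<And>x. x \<in> S \<Longrightarrow> Re (\<phi> x) = 0" "Re (\<phi> p) > 0"
proof -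
  have ne: "S \<noteq> {}" using assms(1) subspace_0 by blast
  have sub: "sublinear (\<lambda>x. infdist x S)"
  proof (rule sublinearI)
    fix x y
    have "infdist (x + y) S - dist y b \<le> infdist x S" if "b \<in> S" for b
      unfolding infdist_notempty[OF ne, of x]
    proof (rule cINF_greatest[OF ne])
      fix a assume "a \<in> S"
      then have "infdist (x + y) S \<le> dist (x + y) (a + b)"
        using that assms(1) by (intro infdist_le subspace_add)
      also have "\<dots> \<le> dist x a + dist y b" by (rule dist_triangle_add)
      finally show "infdist (x + y) S - dist y b \<le> dist x a" by simp
    qed
    then have "infdist (x + y) S - infdist x S \<le> infdist y S"
      unfolding infdist_notempty[OF ne, of y] by (intro cINF_greatest[OF ne]) (simp add: algebra_simps)
    then show "infdist (x + y) S \<le> infdist x S + infdist y S" by simp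
  next
    fix r :: real and x assume r: "0 < r"
    have "infdist (r *\<^sub>R x) S / r \<le> infdist x S"
      unfolding infdist_notempty[OF ne, of x]
    proof (rule cINF_greatest[OF ne])
      fix a assume "a \<in> S"
      then have "infdist (r *\<^sub>R x) S \<le> dist (r *\<^sub>R x) (r *\<^sub>R a)"
        using assms(1) by (intro infdist_le subspace_scale)
      also have "\<dots> = r * dist x a" 
        unfolding dist_norm scaleR_diff_right[symmetric] norm_scaleR using r by simp
      finally show "infdist (r *\<^sub>R x) S / r \<le> dist x a" using r by (simp add: field_simps)
    qed
    then show "infdist (r *\<^sub>R x) S \<le> r * infdist x S" using r by (simp add: field_simps)
  next
    show "infdist 0 S = 0" using subspace_0[OF assms(1)] by simp
  qed
  have "infdist x S \<le> norm x" for x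
    using infdist_le[OF subspace_0[OF assms(1)], of x] by simp
  then obtain \<phi> where \<phi>: "\<phi> \<in> cdual" "\<And>x. Re (\<phi> x) \<le> infdist x S" "Re (\<phi> p) = infdist p S"
    using hahn_banach_complex[OF sub] by metis
  have "Re (\<phi> x) = 0" if "x \<in> S" for x
    using \<phi>(2)[of x] \<phi>(2)[of "-x"] that subspace_neg[OF assms(1) that] \<phi>(1)
    by (simp add: cdual_def clinear_minus)
  moreover have "infdist p S > 0"
    using assms(2) in_closure_iff_infdist_zero[OF ne] infdist_nonneg[of p S] by force
  ultimately show ?thesis using that \<phi> by metis
qed

lemma scaleC_0: "0 *\<^sub>C x = 0" "c *\<^sub>C 0 = 0"
  using norm_scaleC[of 0 x] norm_scaleC[of c 0] by simp_all

lemma csubspace_imp_subspace: "csubspace S \<Longrightarrow> subspace S"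
  unfolding csubspace_def subspace_def by (metis scaleC_of_real)

lemma cdual_annihilator_closure:
  fixes S :: "'a::complex_banach set"
  assumes S: "csubspace S" and ann: "\<And>\<phi>. \<phi> \<in> cdual \<Longrightarrow> (\<And>x. x \<in> S \<Longrightarrow> \<phi> x = 0) \<Longrightarrow> \<phi> p = 0"
  shows "p \<in> closure S"
proof (rule ccontr)
  assume "p \<notin> closure S"
  then obtain \<phi> where \<phi>: "\<phi> \<in> cdual" "\<And>x. x \<in> S \<Longrightarrow> Re (\<phi> x) = 0" "Re (\<phi> p) > 0"
    using cdual_separates_closed_subspace[OF csubspace_imp_subspace[OF S]] by blast
  have "\<phi> x = 0" if "x \<in> S" for x
  proof -
    \<comment> \<open>For a complex subspace, vanishing of the real part at i x is vanishing of the
      imaginary part at x.\<close>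
    have "Re (\<phi> (\<i> *\<^sub>C x)) = 0" using \<phi>(2) S that by (simp add: csubspace_def)
    then show ?thesis
      using \<phi>(1) \<phi>(2)[OF that] by (simp add: cdual_def clinear_def scaleC_complex_def complex_eq_iff)
  qed
  then show False using ann[OF \<phi>(1)] \<phi>(3) by simp
qed

text \<open>Makes E x E, where the graph lives, a complex Banach space, so that the duality results
  for a single space apply to graphs; the same holds for the sum of two copies of the
  predual.\<close>

instantiation prod :: (complex_banach, complex_banach) complex_banach
begin

definition scaleC_prod :: "complex \<Rightarrow> 'a \<times> 'b \<Rightarrow> 'a \<times> 'b"
  where "scaleC_prod c v = (c *\<^sub>C fst v, c *\<^sub>C snd v)"

instance
proof
  fix a b :: complex and r :: real and x y :: "'a \<times> 'b"
  show "norm (a *\<^sub>C x) = cmod a * norm x"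
    by (simp add: scaleC_prod_def norm_prod_def norm_scaleC power_mult_distrib real_sqrt_mult
        flip: distrib_left)
qed (simp_all add: scaleC_prod_def scaleC_add_right scaleC_add_left scaleC_scaleC scaleC_of_real
    scaleR_prod_def)

end

subsection \<open>Gaussian integrals\<close>

text \<open>The function 1 / (1 + t^2) is the common majorant for all smearing kernels: it is
  integrable, and its primitive arctan makes the tails explicit.\<close>

lemma integrable_inverse_1_plus_square_UNIV: "integrable lborel (\<lambda>t::real. inverse (1 + t\<^sup>2))"
proof -
  have "einterval (-\<infinity>) \<infinity> = UNIV" by (auto simp: einterval_def)
  then show ?thesis using integrable_inverse_1_plus_square by (simp add: set_integrable_def)
qed

lemma integrable_inverse_square_bound:
  fixes F :: "real \<Rightarrow> complex"
  assumes "continuous_on UNIV F" "\<And>t. norm (F t) \<le> C * inverse (1 + t\<^sup>2)"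
  shows "integrable lborel F"
proof (rule Bochner_Integration.integrable_bound)
  show "integrable lborel (\<lambda>t. C * inverse (1 + t\<^sup>2))"
    using integrable_inverse_1_plus_square_UNIV by simp
  show "F \<in> borel_measurable lborel"
    using borel_measurable_continuous_onI[OF assms(1)] by simp
  show "AE t in lborel. norm (F t) \<le> norm (C * inverse (1 + t\<^sup>2))"
    using assms(2) by (auto intro!: AE_I2 order_trans[OF assms(2) abs_ge_self] simp del: norm_mult)
qed

section \<open>Integrals over the line as limits over symmetric intervals\<close>

lemma has_integral_inverse_1_plus_square:
  "a \<le> b \<Longrightarrow> ((\<lambda>t. C * inverse (1 + t\<^sup>2)) has_integral (C * arctan b - C * arctan a)) {a..b}"
  by (rule fundamental_theorem_of_calculus)
     (auto intro!: derivative_eq_intros simp flip: has_real_derivative_iff_has_vector_derivative)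

lemma norm_integral_inverse_square_bound:
  fixes F :: "real \<Rightarrow> 'a::banach"
  assumes "continuous_on UNIV F" "\<And>t. norm (F t) \<le> C * inverse (1 + t\<^sup>2)" "a \<le> b"
  shows "norm (integral {a..b} F) \<le> C * arctan b - C * arctan a"
proof -
  have "norm (integral {a..b} F) \<le> integral {a..b} (\<lambda>t. C * inverse (1 + t\<^sup>2))"
  proof (rule integral_norm_bound_integral)
    show "F integrable_on {a..b}"
      using assms(1) by (intro integrable_continuous_interval) (auto intro: continuous_on_subset)
  qed (use has_integral_inverse_1_plus_square[OF assms(3)] assms(2) in \<open>auto simp: integrable_on_def\<close>)
  then show ?thesis
    using integral_unique[OF has_integral_inverse_1_plus_square[OF assms(3)], of C] by simp
qed

text \<open>The two missing pieces contribute at most C * (arctan b - arctan a) each, and arctan b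
  stays below pi / 2. The bound does not involve b, so it serves both as a Cauchy modulus and as a
  rate of convergence.\<close>

lemma norm_diff_integral_symmetric:
  fixes F :: "real \<Rightarrow> 'a::banach"
  assumes F: "continuous_on UNIV F" "\<And>t. norm (F t) \<le> C * inverse (1 + t\<^sup>2)" and "0 \<le> a" "a \<le> b"
  shows "norm (integral {-b..b} F - integral {-a..a} F) \<le> C * (pi - 2 * arctan a)"
proof -
  have int: "F integrable_on {x..y}" for x y
    using F(1) by (intro integrable_continuous_interval) (auto intro: continuous_on_subset)
  have "0 \<le> C" using F(2)[of 0] by (simp add: order_trans[OF norm_ge_zero])
  have "integral {-b..b} F = integral {-b..-a} F + integral {-a..b} F"
    using assms(3,4) int by (intro Henstock_Kurzweil_Integration.integral_combine[symmetric]) auto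
  also have "integral {-a..b} F = integral {-a..a} F + integral {a..b} F"
    using assms(3,4) int by (intro Henstock_Kurzweil_Integration.integral_combine[symmetric]) auto
  finally have "norm (integral {-b..b} F - integral {-a..a} F)
      = norm (integral {-b..-a} F + integral {a..b} F)" by simp
  also have "\<dots> \<le> norm (integral {-b..-a} F) + norm (integral {a..b} F)" by (rule norm_triangle_ineq)
  also have "\<dots> \<le> (C * arctan (-a) - C * arctan (-b)) + (C * arctan b - C * arctan a)"
    using assms by (intro add_mono norm_integral_inverse_square_bound) auto
  also have "\<dots> = C * (2 * arctan b - 2 * arctan a)" by (simp add: arctan_minus algebra_simps)
  also have "\<dots> \<le> C * (pi - 2 * arctan a)"
    using \<open>0 \<le> C\<close> arctan_ubound[of b] by (intro mult_left_mono) auto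
  finally show ?thesis .
qed

lemma tendsto_arctan_tail: "(\<lambda>n. C * (pi - 2 * arctan (real n))) \<longlonglongrightarrow> 0"
proof -
  have "(\<lambda>n. arctan (real n)) \<longlonglongrightarrow> pi / 2"
    by (rule filterlim_compose[OF tendsto_arctan_at_top filterlim_real_sequentially])
  then have "(\<lambda>n. C * (pi - 2 * arctan (real n))) \<longlonglongrightarrow> C * (pi - 2 * (pi / 2))"
    by (intro tendsto_intros)
  then show ?thesis by simp
qed

text \<open>Provides integrals over the line with values in an arbitrary Banach space, with no
  separability; the application is to orbits in the predual.\<close>

lemma convergent_integral_symmetric:
  fixes F :: "real \<Rightarrow> 'a::banach"
  assumes F: "continuous_on UNIV F" "\<And>t. norm (F t) \<le> C * inverse (1 + t\<^sup>2)"
  shows "convergent (\<lambda>n. integral {- real n..real n} F)"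
proof (rule Cauchy_convergent, rule metric_CauchyI)
  fix e :: real assume "0 < e"
  have "\<forall>\<^sub>F n in sequentially. C * (pi - 2 * arctan (real n)) < e / 2"
    using \<open>0 < e\<close> by (intro order_tendstoD(2)[OF tendsto_arctan_tail]) simp
  then obtain N where N: "C * (pi - 2 * arctan (real N)) < e / 2"
    by (auto simp: eventually_sequentially)
  have "dist (integral {- real n..real n} F) (integral {- real N..real N} F) < e / 2" if "n \<ge> N" for n
    using norm_diff_integral_symmetric[OF F, of N n] that N by (simp add: dist_norm)
  then show "\<exists>M. \<forall>m\<ge>M. \<forall>n\<ge>M. dist (integral {- real m..real m} F) (integral {- real n..real n} F) < e"
    by (metis dist_commute dist_triangle_half_l)
qed

text \<open>Connects the truncated integrals with the Lebesgue integral for scalar integrands, so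
  that a vector-valued limit can be identified after pairing.\<close>

lemma tendsto_integral_symmetric:
  fixes F :: "real \<Rightarrow> complex"
  assumes F: "continuous_on UNIV F" "\<And>t. norm (F t) \<le> C * inverse (1 + t\<^sup>2)"
  shows "(\<lambda>n. integral {- real n..real n} F) \<longlonglongrightarrow> integral\<^sup>L lborel F"
proof -
  have "integral {- real n..real n} F = (\<integral>t. indicator {- real n..real n} t *\<^sub>R F t \<partial>lborel)" for n
    using set_borel_integral_eq_integral(2)[of "{- real n..real n}" F]
      borel_integrable_atLeastAtMost'[of "- real n" "real n" F] F(1)
    by (simp add: set_lebesgue_integral_def continuous_on_subset)
  moreover have "(\<lambda>n. \<integral>t. indicator {- real n..real n} t *\<^sub>R F t \<partial>lborel) \<longlonglongrightarrow> integral\<^sup>L lborel F"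
  proof (rule integral_dominated_convergence)
    show "integrable lborel (\<lambda>t. C * inverse (1 + t\<^sup>2))"
      using integrable_inverse_1_plus_square_UNIV by simp
    show "F \<in> borel_measurable lborel" using borel_measurable_continuous_onI[OF F(1)] by simp
    then show "(\<lambda>t. indicator {- real n..real n} t *\<^sub>R F t) \<in> borel_measurable lborel" for n
      by (intro borel_measurable_scaleR borel_measurable_indicator) auto
    show "AE t in lborel. (\<lambda>n. indicator {- real n..real n} t *\<^sub>R F t) \<longlonglongrightarrow> F t"
    proof (rule AE_I2)
      fix t :: real
      obtain N :: nat where "\<bar>t\<bar> \<le> real N" using real_arch_simple by blast
      then have "\<forall>n\<ge>N. indicator {- real n..real n} t *\<^sub>R F t = F t" by (auto simp: indicator_def)
      then show "(\<lambda>n. indicator {- real n..real n} t *\<^sub>R F t) \<longlonglongrightarrow> F t"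
        by (intro tendsto_eventually) (auto simp: eventually_sequentially)
    qed
    show "AE t in lborel. norm (indicator {- real n..real n} t *\<^sub>R F t) \<le> C * inverse (1 + t\<^sup>2)" for n
      using F(2) order_trans[OF norm_ge_zero F(2)] by (intro AE_I2) (simp add: indicator_def)
  qed
  ultimately show ?thesis by simp
qed

text \<open>The normalising factor c / sqrt pi is left out and is accounted for only in
  \<open>gauss_approximate_identity\<close>. The argument is complex because the kernel will be
  shifted by z.\<close>

definition gauss :: "real \<Rightarrow> complex \<Rightarrow> complex"
  where "gauss c u = exp (- (complex_of_real c * u)\<^sup>2)"

lemma continuous_on_gauss [continuous_intros]:
  "continuous_on S f \<Longrightarrow> continuous_on S (\<lambda>x. gauss c (f x))"
  unfolding gauss_def by (intro continuous_intros)

text \<open>The modulus is exp (c^2 ((Im w)^2 - (t - Re w)^2)). Half of t^2 survives the shift, and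
  exp (- c^2 t^2 / 2) is at most 2 / (1 + t^2) when c \<ge> 1. The constant is the same for all w in
  the disc of radius R, which makes locally uniform limits in w possible.\<close>

lemma norm_gauss_le:
  assumes "1 \<le> c" "norm w \<le> R"
  shows "norm (gauss c (complex_of_real t - w)) \<le> 2 * exp (c\<^sup>2 * R\<^sup>2) * inverse (1 + t\<^sup>2)"
proof -
  have "(Re w)\<^sup>2 + (Im w)\<^sup>2 \<le> R\<^sup>2"
    using power_mono[OF assms(2), of 2] by (simp add: cmod_power2)
  \<comment> \<open>The difference of the two sides is 2 (t / 2 - Re w)^2.\<close>
  moreover have "t\<^sup>2 / 2 \<le> (t - Re w)\<^sup>2 + (Re w)\<^sup>2"
    using zero_le_power2[of "t / 2 - Re w"] by (simp add: power2_eq_square algebra_simps)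
  ultimately have "(Im w)\<^sup>2 - (t - Re w)\<^sup>2 \<le> R\<^sup>2 - t\<^sup>2 / 2" by linarith
  then have "c\<^sup>2 * ((Im w)\<^sup>2 - (t - Re w)\<^sup>2) \<le> c\<^sup>2 * (R\<^sup>2 - t\<^sup>2 / 2)" by (intro mult_left_mono) auto
  moreover have "Re (- (complex_of_real c * (complex_of_real t - w))\<^sup>2) = c\<^sup>2 * ((Im w)\<^sup>2 - (t - Re w)\<^sup>2)"
    by (simp add: power2_eq_square algebra_simps)
  ultimately have "norm (gauss c (complex_of_real t - w)) \<le> exp (c\<^sup>2 * (R\<^sup>2 - t\<^sup>2 / 2))"
    by (simp add: gauss_def)
  also have "\<dots> = exp (c\<^sup>2 * R\<^sup>2) * inverse (exp (c\<^sup>2 * t\<^sup>2 / 2))"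
    using exp_diff[of "c\<^sup>2 * R\<^sup>2" "c\<^sup>2 * t\<^sup>2 / 2"] by (simp only: right_diff_distrib divide_inverse times_divide_eq_right mult.assoc)
  also have "\<dots> \<le> exp (c\<^sup>2 * R\<^sup>2) * inverse ((1 + t\<^sup>2) / 2)"
  proof (intro mult_left_mono le_imp_inverse_le)
    have "1 * t\<^sup>2 \<le> c\<^sup>2 * t\<^sup>2" using assms(1) by (intro mult_right_mono) auto
    then have "(1 + t\<^sup>2) / 2 \<le> 1 + c\<^sup>2 * t\<^sup>2 / 2" by simp
    then show "(1 + t\<^sup>2) / 2 \<le> exp (c\<^sup>2 * t\<^sup>2 / 2)"
      using exp_ge_add_one_self[of "c\<^sup>2 * t\<^sup>2 / 2"] by linarith
  qed (auto simp: add_pos_nonneg)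
  finally show ?thesis by (simp add: field_simps)
qed

lemma norm_gauss_mult_le:
  assumes "1 \<le> c" "norm w \<le> R" "norm a \<le> M"
  shows "norm (gauss c (complex_of_real t - w) * a) \<le> 2 * exp (c\<^sup>2 * R\<^sup>2) * M * inverse (1 + t\<^sup>2)"
proof -
  have "norm (gauss c (complex_of_real t - w) * a) \<le> (2 * exp (c\<^sup>2 * R\<^sup>2) * inverse (1 + t\<^sup>2)) * M"
    unfolding norm_mult by (intro mult_mono norm_gauss_le assms) (auto simp: add_pos_nonneg)
  then show ?thesis by (simp add: mult_ac)
qed

text \<open>Over [-n, n] the integral is entire by differentiation under the integral sign; the
  arctan tail is uniform for w in a unit disc, so the limit is entire.\<close>

lemma holomorphic_gauss_convolution:
  fixes g :: "real \<Rightarrow> complex"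
  assumes c: "1 \<le> c" and g: "continuous_on UNIV g" "\<And>t. norm (g t) \<le> M"
  shows "(\<lambda>w. \<integral>t. gauss c (complex_of_real t - w) * g t \<partial>lborel) holomorphic_on UNIV"
proof (rule holomorphic_uniform_sequence)
  show "(\<lambda>w. integral {- real n..real n} (\<lambda>t. gauss c (complex_of_real t - w) * g t)) holomorphic_on UNIV" for n
    unfolding box_real(2)[symmetric]
  proof (rule leibniz_rule_holomorphic)
    show "((\<lambda>w. gauss c (complex_of_real t - w) * g t) has_field_derivative
        2 * (complex_of_real c)\<^sup>2 * (complex_of_real t - w) * gauss c (complex_of_real t - w) * g t) (at w within UNIV)" for w t
      unfolding gauss_def by (auto intro!: derivative_eq_intros simp: power2_eq_square)
    show "(\<lambda>t. gauss c (complex_of_real t - w) * g t) integrable_on cbox (- real n) (real n)" for w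
      by (intro integrable_continuous continuous_intros continuous_on_subset[OF g(1)]) auto
    show "continuous_on (UNIV \<times> cbox (- real n) (real n)) (\<lambda>(w, t).
        2 * (complex_of_real c)\<^sup>2 * (complex_of_real t - w) * gauss c (complex_of_real t - w) * g t)"
      unfolding case_prod_beta
      by (intro continuous_intros continuous_on_compose2[OF g(1)]) auto
  qed auto
  fix w0 :: complex
  define R where "R = norm w0 + 1"
  define C where "C = 2 * exp (c\<^sup>2 * R\<^sup>2) * M"
  have "uniform_limit (cball w0 1) (\<lambda>n w. integral {- real n..real n} (\<lambda>t. gauss c (complex_of_real t - w) * g t))
      (\<lambda>w. \<integral>t. gauss c (complex_of_real t - w) * g t \<partial>lborel) sequentially"
  proof (rule uniform_limitI)
    fix e :: real assume "0 < e"
    have "\<forall>\<^sub>F n in sequentially. C * (pi - 2 * arctan (real n)) < e"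
      using \<open>0 < e\<close> by (intro order_tendstoD(2)[OF tendsto_arctan_tail])
    then show "\<forall>\<^sub>F n in sequentially. \<forall>w\<in>cball w0 1. dist (integral {- real n..real n} (\<lambda>t. gauss c (complex_of_real t - w) * g t))
        (\<integral>t. gauss c (complex_of_real t - w) * g t \<partial>lborel) < e"
    proof (rule eventually_mono, intro ballI)
      fix n w assume n: "C * (pi - 2 * arctan (real n)) < e" and "w \<in> cball w0 1"
      then have w: "norm w \<le> R" unfolding R_def
        by (metis add.commute dist_commute dist_norm mem_cball norm_triangle_sub order_trans add_right_mono)
      let ?F = "\<lambda>t. gauss c (complex_of_real t - w) * g t"
      have F: "continuous_on UNIV ?F" "norm (?F t) \<le> C * inverse (1 + t\<^sup>2)" for t
        using norm_gauss_mult_le[OF c w g(2)] unfolding C_def by (auto intro!: continuous_intros g)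
      \<comment> \<open>Letting the larger endpoint m tend to infinity turns the estimate between
        two truncations into one between a truncation and the full integral.\<close>
      have "(\<lambda>m. dist (integral {- real n..real n} ?F) (integral {- real m..real m} ?F))
          \<longlonglongrightarrow> dist (integral {- real n..real n} ?F) (integral\<^sup>L lborel ?F)"
        by (intro tendsto_intros tendsto_integral_symmetric[OF F])
      moreover have "\<forall>\<^sub>F m in sequentially.
          dist (integral {- real n..real n} ?F) (integral {- real m..real m} ?F) \<le> C * (pi - 2 * arctan (real n))"
        using eventually_ge_at_top[of n]
        by eventually_elim (use norm_diff_integral_symmetric[OF F, of n] in \<open>auto simp: dist_norm norm_minus_commute\<close>)
      ultimately have "dist (integral {- real n..real n} ?F) (integral\<^sup>L lborel ?F) \<le> C * (pi - 2 * arctan (real n))"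
        by (rule tendsto_upperbound) simp
      then show "dist (integral {- real n..real n} ?F) (integral\<^sup>L lborel ?F) < e" using n by linarith
    qed
  qed
  then show "\<exists>d>0. cball w0 d \<subseteq> UNIV \<and> uniform_limit (cball w0 d) (\<lambda>n w. integral {- real n..real n} (\<lambda>t. gauss c (complex_of_real t - w) * g t))
      (\<lambda>w. \<integral>t. gauss c (complex_of_real t - w) * g t \<partial>lborel) sequentially"
    by (intro exI[of _ 1]) auto
qed simp

lemma gauss_real_integral: "(\<integral>t. gauss 1 (complex_of_real t) \<partial>lborel) = complex_of_real (sqrt pi)"
proof -
  have "has_bochner_integral lborel (\<lambda>t::real. exp (- t\<^sup>2)) (2 *\<^sub>R (sqrt pi / 2))"
    by (rule has_bochner_integral_even_function[OF gaussian_moment_0]) simp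
  then have "integral\<^sup>L lborel (\<lambda>t::real. exp (- t\<^sup>2)) = sqrt pi"
    by (auto dest: has_bochner_integral_integral_eq)
  moreover have "gauss 1 (complex_of_real t) = complex_of_real (exp (- t\<^sup>2))" for t
    unfolding gauss_def by (simp flip: exp_of_real)
  ultimately show ?thesis by (simp only: integral_complex_of_real)
qed

text \<open>Substituting t / (n + 1) absorbs the factor n + 1 and leaves a fixed Gaussian against g
  (t / (n + 1)), which tends to g 0; dominated convergence finishes. Using \<open>Suc n\<close>
  keeps the scale at least 1.\<close>

lemma gauss_approximate_identity:
  fixes g :: "real \<Rightarrow> complex"
  assumes g: "continuous_on UNIV g" "\<And>t. norm (g t) \<le> M"
  shows "(\<lambda>n. of_nat (Suc n) * (\<integral>t. gauss (real (Suc n)) (complex_of_real t) * g t \<partial>lborel))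
    \<longlonglongrightarrow> complex_of_real (sqrt pi) * g 0"
proof -
  let ?s = "\<lambda>n t. gauss 1 (complex_of_real t) * g (t / real (Suc n))"
  have eq: "of_nat (Suc n) * (\<integral>t. gauss (real (Suc n)) (complex_of_real t) * g t \<partial>lborel)
      = integral\<^sup>L lborel (?s n)" for n
  proof -
    have "integral\<^sup>L lborel (?s n) = real (Suc n) *\<^sub>R (\<integral>t. ?s n (0 + real (Suc n) * t) \<partial>lborel)"
      by (subst lborel_integral_real_affine[of "real (Suc n)" _ 0]) auto
    also have "(\<lambda>t. ?s n (0 + real (Suc n) * t)) = (\<lambda>t. gauss (real (Suc n)) (complex_of_real t) * g t)"
      by (auto simp: gauss_def)
    finally show ?thesis by (simp add: scaleR_conv_of_real)
  qed
  moreover have "(\<lambda>n. integral\<^sup>L lborel (?s n)) \<longlonglongrightarrow> (\<integral>t. gauss 1 (complex_of_real t) * g 0 \<partial>lborel)"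
  proof (rule integral_dominated_convergence)
    \<comment> \<open>The majorant is that of \<open>norm_gauss_mult_le\<close> for c = 1, w = 0 and
      R = 0, left unsimplified to match.\<close>
    show "integrable lborel (\<lambda>t. 2 * exp (1\<^sup>2 * 0\<^sup>2) * M * inverse (1 + t\<^sup>2))"
      using integrable_inverse_1_plus_square_UNIV by simp
    show "(\<lambda>t. gauss 1 (complex_of_real t) * g 0) \<in> borel_measurable lborel"
      by (simp, intro borel_measurable_continuous_onI continuous_intros)
    show "?s n \<in> borel_measurable lborel" for n
      by (simp, intro borel_measurable_continuous_onI continuous_intros continuous_on_compose2[OF g(1)]) auto
    show "AE t in lborel. (\<lambda>n. ?s n t) \<longlonglongrightarrow> gauss 1 (complex_of_real t) * g 0"
    proof (intro AE_I2 tendsto_intros)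
      fix t :: real
      have "(\<lambda>n. t / real (Suc n)) \<longlonglongrightarrow> 0" by real_asymp
      moreover have "isCont g 0" using g(1) by (simp add: continuous_on_eq_continuous_at)
      ultimately show "(\<lambda>n. g (t / real (Suc n))) \<longlonglongrightarrow> g 0" by (rule isCont_tendsto_compose[rotated])
    qed
    show "AE t in lborel. norm (?s n t) \<le> 2 * exp (1\<^sup>2 * 0\<^sup>2) * M * inverse (1 + t\<^sup>2)" for n
      using norm_gauss_mult_le[of 1 0 0 _ M] g(2) by (intro AE_I2) simp
  qed
  moreover have "(\<integral>t. gauss 1 (complex_of_real t) * g 0 \<partial>lborel) = complex_of_real (sqrt pi) * g 0"
    by (simp add: gauss_real_integral)
  ultimately show ?thesis unfolding eq by (simp only:)
qed

subsection \<open>Functions on a strip\<close>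

lemma strip_nonreal: "z \<notin> \<real> \<Longrightarrow> strip z = {w. 0 \<le> Im w / Im z \<and> Im w / Im z \<le> 1}"
  by (simp add: strip_def)

lemma Im_nonreal: "z \<notin> \<real> \<Longrightarrow> Im z \<noteq> 0"
  by (simp add: complex_is_Real_iff)

lemma self_in_strip: "z \<in> strip z"
  by (simp add: strip_def complex_is_Real_iff)

lemma open_strip_subset_interior:
  assumes "z \<notin> \<real>" shows "{w. 0 < Im w / Im z \<and> Im w / Im z < 1} \<subseteq> interior (strip z)"
proof (rule interior_maximal)
  show "open {w. 0 < Im w / Im z \<and> Im w / Im z < 1}"
    using Im_nonreal[OF assms] by (intro open_Collect_conj open_Collect_less continuous_intros) auto
qed (auto simp: strip_nonreal assms)

text \<open>For nonreal z, extend h by 0 across the real line. The extension is continuous because h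
  vanishes there, hence holomorphic across the line, and the identity theorem applies. The edge
  through z is reached by continuity. Dividing by Im z treats both signs of Im z at once.\<close>

lemma vanishing_on_strip:
  fixes h :: "complex \<Rightarrow> complex"
  assumes cont: "continuous_on (strip z) h" and hol: "h holomorphic_on interior (strip z)"
    and zero: "\<And>t. h (complex_of_real t) = 0" and w: "w \<in> strip z"
  shows "h w = 0"
proof (cases "z \<in> \<real>")
  case True
  then show ?thesis using w zero by (auto simp: strip_def elim: Reals_cases)
next
  case False
  then have Im: "Im z \<noteq> 0" by (rule Im_nonreal)
  note strip = strip_nonreal[OF False]
  have contL: "continuous_on A (\<lambda>w. Im w / Im z)" for A
    using Im by (intro continuous_intros) auto
  have h_real: "h w = 0" if "Im w = 0" for w
    using that zero[of "Re w"] by (metis complex_is_Real_iff of_real_Re)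
  define S where "S = {w. -1 < Im w / Im z \<and> Im w / Im z < 1}"
  \<comment> \<open>The side of the real line away from z is where g is 0.\<close>
  define g where "g w = (if Im w / Im z \<le> 0 then 0 else h w)" for w
  have openS: "open S" unfolding S_def
    by (intro open_Collect_conj open_Collect_less continuous_intros contL)
  have "convex S"
  proof -
    have "linear (\<lambda>w. Im w / Im z)" by (rule linearI) (auto simp: add_divide_distrib)
    moreover have "S = (\<lambda>w. Im w / Im z) -` {-1<..<1}" by (auto simp: S_def)
    ultimately show ?thesis by (simp only: convex_linear_vimage convex_real_interval)
  qed
  have contg: "continuous_on S g"
    unfolding g_def
  proof (rule continuous_on_cases_le)
    show "continuous_on {w \<in> S. 0 \<le> Im w / Im z} h"
      by (rule continuous_on_subset[OF cont]) (auto simp: S_def strip)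
    fix w assume "Im w / Im z = 0"
    then show "0 = h w" using Im h_real by simp
  qed (auto intro: contL)
  have hol_pos: "g holomorphic_on {w. 0 < Im w / Im z \<and> Im w / Im z < 1}"
    by (rule holomorphic_transform[OF holomorphic_on_subset[OF hol open_strip_subset_interior[OF False]]])
       (auto simp: g_def)
  have hol_neg: "g holomorphic_on {w. Im w / Im z < 0}"
    by (rule holomorphic_transform[of "\<lambda>_. 0"]) (auto simp: g_def)
  \<comment> \<open>Writes the real line as the zero set of an inner product, the form in which the
    pasting theorem takes its line.\<close>
  have dot: "(\<i> / of_real (Im z)) \<bullet> w = Im w / Im z" for w
    by (simp add: inner_complex_def)
  have holg: "g holomorphic_on S"
  proof (rule holomorphic_on_paste_across_line[OF openS _ _ _ contg])
    show "\<i> / of_real (Im z) \<noteq> (0::complex)" using Im by simp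
    show "g holomorphic_on S \<inter> {w. (\<i> / of_real (Im z)) \<bullet> w < 0}"
      unfolding dot by (rule holomorphic_on_subset[OF hol_neg]) auto
    show "g holomorphic_on S \<inter> {w. 0 < (\<i> / of_real (Im z)) \<bullet> w}"
      unfolding dot by (rule holomorphic_on_subset[OF hol_pos]) (auto simp: S_def)
  qed
  have gS: "g w = 0" if "w \<in> S" for w
  proof (rule analytic_continuation_open[where f = g and g = "\<lambda>_. 0" and s = "S \<inter> {w. Im w / Im z < 0}"])
    show "open (S \<inter> {w. Im w / Im z < 0})"
      by (intro open_Int openS open_Collect_less continuous_intros contL)
    have "Complex 0 (- Im z / 2) \<in> S \<inter> {w. Im w / Im z < 0}" using Im by (simp add: S_def)
    then show "S \<inter> {w. Im w / Im z < 0} \<noteq> {}" by blast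
    show "connected S" using \<open>convex S\<close> by (rule convex_connected)
  qed (use openS holg that in \<open>auto simp: g_def\<close>)
  have h0: "h v = 0" if "0 \<le> Im v / Im z" "Im v / Im z < 1" for v
    using gS[of v] that h_real[of v] Im by (auto simp: S_def g_def split: if_splits)
  show ?thesis
  proof (cases "Im w / Im z < 1")
    case True
    then show ?thesis using h0 w strip by simp
  next
    case False
    then have w1: "Im w / Im z = 1" using w strip by simp
    define r where "r n = inverse (real (Suc n))" for n
    have r: "0 < r n" "r n \<le> 1" for n by (auto simp: r_def inverse_le_1_iff)
    \<comment> \<open>These points lie strictly below the far edge (in the normalised height) and
      move towards w perpendicularly to it.\<close>
    define v where "v n = w - (\<i> * of_real (Im z)) * of_real (r n)" for n
    have Imv: "Im (v n) / Im z = 1 - r n" for n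
      using w1 Im by (simp add: v_def diff_divide_distrib)
    have "r \<longlonglongrightarrow> 0" unfolding r_def by (rule LIMSEQ_inverse_real_of_nat)
    then have "v \<longlonglongrightarrow> w - (\<i> * of_real (Im z)) * complex_of_real 0"
      unfolding v_def by (intro tendsto_intros)
    then have "v \<longlonglongrightarrow> w" by simp
    moreover have "v n \<in> strip z" for n using r[of n] by (simp add: strip Imv)
    ultimately have "(\<lambda>n. h (v n)) \<longlonglongrightarrow> h w"
      by (intro continuous_on_tendsto_compose[OF cont _ w]) auto
    moreover have "h (v n) = 0" for n using r[of n] by (intro h0) (simp_all add: Imv)
    ultimately show ?thesis by (simp add: LIMSEQ_const_iff)
  qed
qed

lemma strip_identity:
  fixes f g :: "complex \<Rightarrow> complex"
  assumes "continuous_on (strip z) f" "f holomorphic_on interior (strip z)"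
    and "continuous_on (strip z) g" "g holomorphic_on interior (strip z)"
    and "\<And>t. f (complex_of_real t) = g (complex_of_real t)" and "w \<in> strip z"
  shows "f w = g w"
  using vanishing_on_strip[of z "\<lambda>w. f w - g w" w] assms
  by (simp add: continuous_on_diff holomorphic_on_diff)

subsection \<open>Annihilators of the graph\<close>

lemma isometry_group_clinear: "isometry_group \<alpha> \<Longrightarrow> clinear (\<alpha> t)"
  and isometry_group_norm_le: "isometry_group \<alpha> \<Longrightarrow> norm (\<alpha> t x) \<le> norm x"
  and isometry_group_0: "isometry_group \<alpha> \<Longrightarrow> \<alpha> 0 x = x"
  by (simp_all add: isometry_group_def)

lemma isometry_group_add: "isometry_group \<alpha> \<Longrightarrow> \<alpha> t (\<alpha> s x) = \<alpha> (t + s) x"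
  unfolding isometry_group_def by (metis comp_apply)

lemma isometry_group_bounded_linear: "isometry_group \<alpha> \<Longrightarrow> bounded_linear (\<alpha> t)"
  by (intro bounded_linear_clinearI[of _ 1]) (simp_all add: isometry_group_clinear isometry_group_norm_le)

lemma cdual_clinear: "\<phi> \<in> cdual \<Longrightarrow> clinear \<phi>"
  and cdual_bounded_linear: "\<phi> \<in> cdual \<Longrightarrow> bounded_linear \<phi>"
  by (simp_all add: cdual_def)

lemma cdual_orbit_bound:
  assumes "isometry_group \<alpha>" "\<phi> \<in> cdual"
  obtains K where "0 \<le> K" "\<And>t x. norm (\<phi> (\<alpha> t x)) \<le> norm x * K"
proof -
  obtain K where K: "0 \<le> K" "\<And>x. norm (\<phi> x) \<le> norm x * K"
    using bounded_linear.nonneg_bounded[OF cdual_bounded_linear[OF assms(2)]] by blast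
  have "norm (\<phi> (\<alpha> t x)) \<le> norm x * K" for t x
    using K(2)[of "\<alpha> t x"] mult_right_mono[OF isometry_group_norm_le[OF assms(1), of t x] K(1)] by linarith
  then show ?thesis using that K(1) by blast
qed

lemma smeared_bound:
  fixes k g :: "real \<Rightarrow> complex"
  assumes "\<And>t. norm (k t) \<le> C * inverse (1 + t\<^sup>2)" "\<And>t. norm (g t) \<le> M"
  shows "norm (k t * g t) \<le> C * M * inverse (1 + t\<^sup>2)"
proof -
  have "norm (k t * g t) \<le> (C * inverse (1 + t\<^sup>2)) * M"
    unfolding norm_mult
    by (intro mult_mono assms order_trans[OF norm_ge_zero assms(1)] norm_ge_zero)
  then show ?thesis by (simp add: mult_ac)
qed

lemma smeared_integrable:
  fixes k g :: "real \<Rightarrow> complex"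
  assumes "continuous_on UNIV k" "\<And>t. norm (k t) \<le> C * inverse (1 + t\<^sup>2)"
    and "continuous_on UNIV g" "\<And>t. norm (g t) \<le> M"
  shows "integrable lborel (\<lambda>t. k t * g t)"
proof (rule integrable_inverse_square_bound)
  show "continuous_on UNIV (\<lambda>t. k t * g t)" by (intro continuous_on_mult assms)
qed (rule smeared_bound[OF assms(2,4)])

lemma smeared_cdual:
  assumes grp: "isometry_group \<alpha>" and \<phi>: "\<phi> \<in> cdual"
    and orbit: "\<And>x. continuous_on UNIV (\<lambda>t. \<phi> (\<alpha> t x))"
    and k: "continuous_on UNIV k" "\<And>t. norm (k t) \<le> C * inverse (1 + t\<^sup>2)"
  shows "(\<lambda>x. \<integral>t. k t * \<phi> (\<alpha> t x) \<partial>lborel) \<in> cdual"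
proof -
  obtain K where K: "0 \<le> K" "\<And>t x. norm (\<phi> (\<alpha> t x)) \<le> norm x * K"
    using cdual_orbit_bound[OF grp \<phi>] by metis
  have int: "integrable lborel (\<lambda>t. k t * \<phi> (\<alpha> t x))" for x
    using smeared_integrable[OF k orbit K(2)] .
  have lin: "\<phi> (\<alpha> t (x + y)) = \<phi> (\<alpha> t x) + \<phi> (\<alpha> t y)" "\<phi> (\<alpha> t (c *\<^sub>C x)) = c * \<phi> (\<alpha> t x)" for t x y c
    using cdual_clinear[OF \<phi>] isometry_group_clinear[OF grp]
    by (simp_all add: clinear_add clinear_scaleC scaleC_complex_def)
  have cl: "clinear (\<lambda>x. \<integral>t. k t * \<phi> (\<alpha> t x) \<partial>lborel)"
    unfolding clinear_def scaleC_complex_def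
    by (simp add: lin distrib_left int mult.left_commute[of "k _"])
  have "norm (\<integral>t. k t * \<phi> (\<alpha> t x) \<partial>lborel) \<le> norm x * (C * K * (\<integral>t. inverse (1 + t\<^sup>2) \<partial>lborel))" for x
  proof -
    have "norm (\<integral>t. k t * \<phi> (\<alpha> t x) \<partial>lborel) \<le> (\<integral>t. norm (k t * \<phi> (\<alpha> t x)) \<partial>lborel)"
      by (rule integral_norm_bound)
    also have "\<dots> \<le> (\<integral>t. C * (norm x * K) * inverse (1 + t\<^sup>2) \<partial>lborel)"
      using smeared_bound[OF k(2) K(2)] integrable_inverse_1_plus_square_UNIV
      by (intro integral_mono integrable_norm int) auto
    finally show ?thesis by (simp add: mult_ac)
  qed
  then show ?thesis using cl bounded_linear_clinearI[OF cl] unfolding cdual_def by blast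
qed

text \<open>Isolates what the two cases share: \<Phi> is the full dual in the norm case and the set
  of evaluations at points of the predual in the weak-star case. \<open>separating\<close> yields
  uniqueness of extensions, \<open>invariant\<close> yields commutation with the group, and
  \<open>smeared\<close> keeps the regularised functionals within \<Phi>, where density of
  \<open>D\<close> can be used.\<close>

locale dual_family =
  fixes \<alpha> :: "real \<Rightarrow> 'e::complex_banach \<Rightarrow> 'e"
    and T :: "'e topology"
    and \<Phi> :: "('e \<Rightarrow> complex) set"
  assumes group: "isometry_group \<alpha>"
    and subset_cdual: "\<Phi> \<subseteq> cdual"
    and continuous: "\<phi> \<in> \<Phi> \<Longrightarrow> continuous_map T euclidean \<phi>"
    and separating: "(\<And>\<phi>. \<phi> \<in> \<Phi> \<Longrightarrow> \<phi> x = \<phi> y) \<Longrightarrow> x = y"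
    and add_closed: "\<phi> \<in> \<Phi> \<Longrightarrow> \<psi> \<in> \<Phi> \<Longrightarrow> (\<lambda>x. \<phi> x + \<psi> x) \<in> \<Phi>"
    and invariant: "\<phi> \<in> \<Phi> \<Longrightarrow> (\<lambda>x. \<phi> (\<alpha> t x)) \<in> \<Phi>"
    and orbit_continuous: "\<phi> \<in> \<Phi> \<Longrightarrow> continuous_on UNIV (\<lambda>t. \<phi> (\<alpha> t x))"
    and smeared: "\<phi> \<in> \<Phi> \<Longrightarrow> continuous_on UNIV k \<Longrightarrow> (\<And>t. norm (k t) \<le> C * inverse (1 + t\<^sup>2)) \<Longrightarrow>
      (\<lambda>x. \<integral>t. k t * \<phi> (\<alpha> t x) \<partial>lborel) \<in> \<Phi>"
begin

lemma clinear_Phi: "\<phi> \<in> \<Phi> \<Longrightarrow> clinear \<phi>"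
  and cdual_Phi: "\<phi> \<in> \<Phi> \<Longrightarrow> \<phi> \<in> cdual"
  using subset_cdual cdual_clinear by blast+

lemma extension_continuous:
  assumes "is_extension T \<alpha> z x f" "\<phi> \<in> \<Phi>"
  shows "continuous_on (strip z) (\<lambda>w. \<phi> (f w))"
proof -
  have "continuous_map (top_of_set (strip z)) euclidean (\<phi> \<circ> f)"
    using assms(1) continuous[OF assms(2)]
    by (intro continuous_map_compose) (auto simp: is_extension_def regular_on_strip_def)
  then show ?thesis by (simp add: o_def)
qed

lemma extension_holomorphic:
  assumes "is_extension T \<alpha> z x f" "\<phi> \<in> \<Phi>"
  shows "(\<lambda>w. \<phi> (f w)) holomorphic_on interior (strip z)"
proof (rule holomorphic_onI)
  fix w assume "w \<in> interior (strip z)"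
  then obtain d where d: "(f has_derivative (\<lambda>h. h *\<^sub>C d)) (at w)"
    using assms(1) by (auto simp: is_extension_def regular_on_strip_def analytic_on_open_def)
  have "((\<lambda>w. \<phi> (f w)) has_derivative (\<lambda>h. \<phi> (h *\<^sub>C d))) (at w)"
    using bounded_linear.has_derivative[OF cdual_bounded_linear[OF cdual_Phi[OF assms(2)]] d] .
  then have "((\<lambda>w. \<phi> (f w)) has_field_derivative \<phi> d) (at w)"
    using clinear_scaleC[OF clinear_Phi[OF assms(2)]]
    by (simp add: has_field_derivative_def scaleC_complex_def mult_commute_abs)
  then show "(\<lambda>w. \<phi> (f w)) field_differentiable at w within interior (strip z)"
    using field_differentiable_at_within field_differentiable_def by blast
qed

lemma extension_real: "is_extension T \<alpha> z x f \<Longrightarrow> f (complex_of_real t) = \<alpha> t x"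
  by (simp add: is_extension_def)

text \<open>Two extensions agree on the real line, so their images under each member of \<Phi> agree
  on the strip, and \<Phi> separates points. This justifies the definite description in
  \<open>group_ext\<close>.\<close>

lemma group_ext_eq:
  assumes "is_extension T \<alpha> z x f" shows "group_ext T \<alpha> z x = f z"
  unfolding group_ext_def
proof (rule the_equality)
  show "\<exists>g. is_extension T \<alpha> z x g \<and> g z = f z" using assms by blast
  fix y assume "\<exists>g. is_extension T \<alpha> z x g \<and> g z = y"
  then obtain g where g: "is_extension T \<alpha> z x g" "g z = y" by blast
  have "\<phi> (g z) = \<phi> (f z)" if "\<phi> \<in> \<Phi>" for \<phi>
    by (rule strip_identity[where z = z])
       (use that g(1) assms in \<open>auto simp: extension_continuous extension_holomorphic extension_real self_in_strip\<close>)
  then show "y = f z" using separating g(2) by blast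
qed

lemma ext_domE:
  assumes "x \<in> ext_dom T \<alpha> z"
  obtains f where "is_extension T \<alpha> z x f" "group_ext T \<alpha> z x = f z"
  using assms group_ext_eq by (auto simp: ext_dom_def)

text \<open>That x + y lies in the domain is assumed, since for \<open>D\<close> it follows from
  being a subspace inside the domain; thus T need not be shown compatible with addition.\<close>

lemma group_ext_add:
  assumes "x \<in> ext_dom T \<alpha> z" "y \<in> ext_dom T \<alpha> z" "x + y \<in> ext_dom T \<alpha> z"
  shows "group_ext T \<alpha> z (x + y) = group_ext T \<alpha> z x + group_ext T \<alpha> z y"
proof -
  obtain f where f: "is_extension T \<alpha> z x f" "group_ext T \<alpha> z x = f z" using assms(1) by (rule ext_domE)
  obtain g where g: "is_extension T \<alpha> z y g" "group_ext T \<alpha> z y = g z" using assms(2) by (rule ext_domE)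
  obtain h where h: "is_extension T \<alpha> z (x + y) h" "group_ext T \<alpha> z (x + y) = h z" using assms(3) by (rule ext_domE)
  have "\<phi> (h z) = \<phi> (f z + g z)" if \<phi>: "\<phi> \<in> \<Phi>" for \<phi>
  proof -
    note lin = clinear_add[OF clinear_Phi[OF \<phi>]] clinear_add[OF isometry_group_clinear[OF group]]
    have "\<phi> (h z) = \<phi> (f z) + \<phi> (g z)"
      by (rule strip_identity[where z = z])
         (use \<phi> f(1) g(1) h(1) in \<open>auto intro!: continuous_on_add holomorphic_on_add
           simp: extension_continuous extension_holomorphic extension_real self_in_strip lin\<close>)
    then show ?thesis by (simp add: lin)
  qed
  then show ?thesis using separating f g h by auto
qed

lemma group_ext_scaleC:
  assumes "x \<in> ext_dom T \<alpha> z" "c *\<^sub>C x \<in> ext_dom T \<alpha> z"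
  shows "group_ext T \<alpha> z (c *\<^sub>C x) = c *\<^sub>C group_ext T \<alpha> z x"
proof -
  obtain f where f: "is_extension T \<alpha> z x f" "group_ext T \<alpha> z x = f z" using assms(1) by (rule ext_domE)
  obtain h where h: "is_extension T \<alpha> z (c *\<^sub>C x) h" "group_ext T \<alpha> z (c *\<^sub>C x) = h z" using assms(2) by (rule ext_domE)
  have "\<phi> (h z) = \<phi> (c *\<^sub>C f z)" if \<phi>: "\<phi> \<in> \<Phi>" for \<phi>
  proof -
    note lin = clinear_scaleC[OF clinear_Phi[OF \<phi>]] clinear_scaleC[OF isometry_group_clinear[OF group]]
    have "\<phi> (h z) = c * \<phi> (f z)"
      by (rule strip_identity[where z = z])
         (use \<phi> f(1) h(1) in \<open>auto intro!: continuous_on_mult holomorphic_on_mult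
           simp: extension_continuous extension_holomorphic extension_real self_in_strip lin scaleC_complex_def\<close>)
    then show ?thesis by (simp add: lin scaleC_complex_def)
  qed
  then show ?thesis using separating f h by auto
qed

text \<open>For \<phi> in \<Phi> the functional \<phi> o \<open>\<alpha> t\<close> is again in
  \<Phi>, so \<phi> (\<open>\<alpha> t\<close> (f w)) is regular on the strip, and on the real line
  it is the orbit of \<open>\<alpha> t x\<close> because the group is commutative.\<close>

lemma group_ext_commute:
  assumes "x \<in> ext_dom T \<alpha> z" "\<alpha> t x \<in> ext_dom T \<alpha> z"
  shows "group_ext T \<alpha> z (\<alpha> t x) = \<alpha> t (group_ext T \<alpha> z x)"
proof -
  obtain f where f: "is_extension T \<alpha> z x f" "group_ext T \<alpha> z x = f z" using assms(1) by (rule ext_domE)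
  obtain h where h: "is_extension T \<alpha> z (\<alpha> t x) h" "group_ext T \<alpha> z (\<alpha> t x) = h z" using assms(2) by (rule ext_domE)
  have "\<phi> (h z) = \<phi> (\<alpha> t (f z))" if \<phi>: "\<phi> \<in> \<Phi>" for \<phi>
    by (rule strip_identity[where z = z])
       (use \<phi> f(1) h(1) extension_continuous[OF f(1) invariant[OF \<phi>]] extension_holomorphic[OF f(1) invariant[OF \<phi>]]
         in \<open>auto simp: extension_continuous extension_holomorphic extension_real self_in_strip
           isometry_group_add[OF group] add.commute\<close>)
  then show ?thesis using separating f h by auto
qed

lemma graph_csubspace:
  assumes D: "csubspace D" "D \<subseteq> ext_dom T \<alpha> z"
  shows "csubspace {(x, group_ext T \<alpha> z x) | x. x \<in> D}"
proof -
  have D0: "0 \<in> D" and Dadd: "\<And>x y. x \<in> D \<Longrightarrow> y \<in> D \<Longrightarrow> x + y \<in> D"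
    and Dscale: "\<And>c x. x \<in> D \<Longrightarrow> c *\<^sub>C x \<in> D"
    using D(1) by (auto simp: csubspace_def)
  have "group_ext T \<alpha> z (0 *\<^sub>C 0) = 0 *\<^sub>C group_ext T \<alpha> z 0"
    using D(2) D0 by (intro group_ext_scaleC) (auto simp: scaleC_0)
  then have "group_ext T \<alpha> z 0 = 0" by (simp add: scaleC_0)
  then show ?thesis
    using D0 Dadd Dscale D(2) group_ext_add group_ext_scaleC
    unfolding csubspace_def by (auto simp: scaleC_prod_def zero_prod_def subset_iff)
qed

text \<open>On the right the unbounded operator has disappeared: its effect is now a complex shift
  of the kernel, and the expression makes sense for every vector.\<close>

lemma gauss_smeared_ext:
  assumes \<psi>: "\<psi> \<in> \<Phi>" and c: "1 \<le> c" and x: "x \<in> ext_dom T \<alpha> z"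
  shows "(\<integral>t. gauss c (complex_of_real t) * \<psi> (\<alpha> t (group_ext T \<alpha> z x)) \<partial>lborel)
    = (\<integral>t. gauss c (complex_of_real t - z) * \<psi> (\<alpha> t x) \<partial>lborel)"
proof -
  obtain f where f: "is_extension T \<alpha> z x f" "group_ext T \<alpha> z x = f z" using x by (rule ext_domE)
  define \<psi>' where "\<psi>' v = (\<integral>t. gauss c (complex_of_real t) * \<psi> (\<alpha> t v) \<partial>lborel)" for v
  define H where "H w = (\<integral>t. gauss c (complex_of_real t - w) * \<psi> (\<alpha> t x) \<partial>lborel)" for w
  have "\<psi>' \<in> \<Phi>"
    unfolding \<psi>'_def
    using norm_gauss_le[OF c, of 0 0]
    by (intro smeared[OF \<psi>, where C = "2 * exp (c\<^sup>2 * 0\<^sup>2)"] continuous_intros) auto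
  obtain K where K: "norm (\<psi> (\<alpha> t x)) \<le> norm x * K" for t
    using cdual_orbit_bound[OF group cdual_Phi[OF \<psi>]] by metis
  have H: "H holomorphic_on UNIV"
    unfolding H_def by (rule holomorphic_gauss_convolution[OF c orbit_continuous[OF \<psi>] K])
  have "\<psi>' (f z) = H z"
  proof (rule strip_identity[where z = z and w = z and f = "\<lambda>w. \<psi>' (f w)" and g = H])
    show "\<psi>' (f (complex_of_real s)) = H (complex_of_real s)" for s
    proof -
      \<comment> \<open>Translation invariance of Lebesgue measure moves the shift from the kernel
        to the orbit.\<close>
      have "H (complex_of_real s)
          = (\<integral>t. gauss c (complex_of_real (s + 1 * t) - complex_of_real s) * \<psi> (\<alpha> (s + 1 * t) x) \<partial>lborel)"
        unfolding H_def by (subst lborel_integral_real_affine[of 1 _ s]) auto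
      then show ?thesis
        by (simp add: \<psi>'_def extension_real[OF f(1)] isometry_group_add[OF group] add.commute)
    qed
    show "continuous_on (strip z) (\<lambda>w. \<psi>' (f w))" "(\<lambda>w. \<psi>' (f w)) holomorphic_on interior (strip z)"
      using extension_continuous[OF f(1) \<open>\<psi>' \<in> \<Phi>\<close>] extension_holomorphic[OF f(1) \<open>\<psi>' \<in> \<Phi>\<close>] by auto
    show "continuous_on (strip z) H" "H holomorphic_on interior (strip z)"
      using H holomorphic_on_imp_continuous_on holomorphic_on_subset by blast+
  qed (rule self_in_strip)
  then show ?thesis by (simp add: \<psi>'_def H_def f(2))
qed

text \<open>Density of \<open>D\<close> enters only through \<open>dense\<close>, a condition on
  functionals that follows from norm density and from weak-star density alike.\<close>

lemma graph_annihilator: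
  assumes inv: "group_invariant \<alpha> D" and dom: "D \<subseteq> ext_dom T \<alpha> z"
    and dense: "\<And>\<phi> v. \<phi> \<in> \<Phi> \<Longrightarrow> (\<And>y. y \<in> D \<Longrightarrow> \<phi> y = 0) \<Longrightarrow> \<phi> v = 0"
    and \<phi>: "\<phi> \<in> \<Phi>" and \<psi>: "\<psi> \<in> \<Phi>"
    and ann: "\<And>y. y \<in> D \<Longrightarrow> \<phi> y + \<psi> (group_ext T \<alpha> z y) = 0"
    and x: "x \<in> ext_dom T \<alpha> z"
  shows "\<phi> x + \<psi> (group_ext T \<alpha> z x) = 0"
proof -
  have gauss_bound: "norm (gauss c (complex_of_real t - w)) \<le> 2 * exp (c\<^sup>2 * (norm w)\<^sup>2) * inverse (1 + t\<^sup>2)"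
    if "1 \<le> c" for c t w using norm_gauss_le[OF that, of w "norm w"] by simp
  have int: "integrable lborel (\<lambda>t. gauss c (complex_of_real t - w) * \<xi> (\<alpha> t v))"
    if c: "1 \<le> c" and \<xi>: "\<xi> \<in> \<Phi>" for c w \<xi> v
  proof -
    obtain K where K: "norm (\<xi> (\<alpha> t v)) \<le> norm v * K" for t
      using cdual_orbit_bound[OF group cdual_Phi[OF \<xi>]] by metis
    show ?thesis
      by (rule smeared_integrable[OF _ gauss_bound[OF c] orbit_continuous[OF \<xi>] K])
         (intro continuous_intros)
  qed
  have sum0: "(\<integral>t. gauss c (complex_of_real t) * \<phi> (\<alpha> t x) \<partial>lborel)
      + (\<integral>t. gauss c (complex_of_real t) * \<psi> (\<alpha> t (group_ext T \<alpha> z x)) \<partial>lborel) = 0" if c: "1 \<le> c" for c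
  proof -
    \<comment> \<open>The shift 0 in the first term is written out so that both terms have the shape
      of \<open>gauss_bound\<close>.\<close>
    define \<xi> where "\<xi> v = (\<integral>t. gauss c (complex_of_real t - 0) * \<phi> (\<alpha> t v) \<partial>lborel)
        + (\<integral>t. gauss c (complex_of_real t - z) * \<psi> (\<alpha> t v) \<partial>lborel)" for v
    have "\<xi> \<in> \<Phi>" unfolding \<xi>_def
      by (intro add_closed smeared[OF \<phi> _ gauss_bound[OF c]] smeared[OF \<psi> _ gauss_bound[OF c]] continuous_intros)
    moreover have "\<xi> y = 0" if y: "y \<in> D" for y
    proof -
      have Dt: "\<alpha> t y \<in> D" for t using inv y by (simp add: group_invariant_def)
      \<comment> \<open>The annihilator relation at \<open>\<alpha> t y\<close>, which lies in
        \<open>D\<close> by invariance, combined with commutation.\<close>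
      have "\<phi> (\<alpha> t y) + \<psi> (\<alpha> t (group_ext T \<alpha> z y)) = 0" for t
        using ann[OF Dt] group_ext_commute[OF subsetD[OF dom y] subsetD[OF dom Dt]] by simp
      then have "(\<integral>t. gauss c (complex_of_real t - 0) * \<phi> (\<alpha> t y)
          + gauss c (complex_of_real t - 0) * \<psi> (\<alpha> t (group_ext T \<alpha> z y)) \<partial>lborel) = 0"
        unfolding distrib_left[symmetric] by simp
      then show ?thesis
        using gauss_smeared_ext[OF \<psi> c, of y z] dom y int[OF c \<phi>, of 0] int[OF c \<psi>, of 0]
        unfolding \<xi>_def by (subst (asm) Bochner_Integration.integral_add) auto
    qed
    ultimately have "\<xi> x = 0" by (rule dense)
    then show ?thesis using gauss_smeared_ext[OF \<psi> c x] by (simp add: \<xi>_def)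
  qed
  obtain K where K: "norm (\<phi> (\<alpha> t x)) \<le> norm x * K" for t
    using cdual_orbit_bound[OF group cdual_Phi[OF \<phi>]] by metis
  obtain L where L: "norm (\<psi> (\<alpha> t (group_ext T \<alpha> z x))) \<le> norm (group_ext T \<alpha> z x) * L" for t
    using cdual_orbit_bound[OF group cdual_Phi[OF \<psi>]] by metis
  have "(\<lambda>n. of_nat (Suc n) * (\<integral>t. gauss (real (Suc n)) (complex_of_real t) * \<phi> (\<alpha> t x) \<partial>lborel)
      + of_nat (Suc n) * (\<integral>t. gauss (real (Suc n)) (complex_of_real t) * \<psi> (\<alpha> t (group_ext T \<alpha> z x)) \<partial>lborel))
    \<longlonglongrightarrow> complex_of_real (sqrt pi) * \<phi> (\<alpha> 0 x) + complex_of_real (sqrt pi) * \<psi> (\<alpha> 0 (group_ext T \<alpha> z x))"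
    by (intro tendsto_add gauss_approximate_identity[OF orbit_continuous[OF \<phi>] K]
        gauss_approximate_identity[OF orbit_continuous[OF \<psi>] L])
  moreover have "of_nat (Suc n) * (\<integral>t. gauss (real (Suc n)) (complex_of_real t) * \<phi> (\<alpha> t x) \<partial>lborel)
      + of_nat (Suc n) * (\<integral>t. gauss (real (Suc n)) (complex_of_real t) * \<psi> (\<alpha> t (group_ext T \<alpha> z x)) \<partial>lborel) = 0" for n
    using sum0[of "real (Suc n)"] unfolding distrib_left[symmetric] by simp
  ultimately have "complex_of_real (sqrt pi) * \<phi> (\<alpha> 0 x) + complex_of_real (sqrt pi) * \<psi> (\<alpha> 0 (group_ext T \<alpha> z x)) = 0"
    by (simp only: LIMSEQ_const_iff)
  then have "complex_of_real (sqrt pi) * (\<phi> x + \<psi> (group_ext T \<alpha> z x)) = 0"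
    by (simp add: isometry_group_0[OF group] distrib_left)
  then show ?thesis by simp
qed

end

section \<open>The norm-continuous case\<close>

lemma is_core_norm_dense:
  fixes \<alpha> :: "real \<Rightarrow> 'e::complex_banach \<Rightarrow> 'e"
  assumes group: "isometry_group \<alpha>" and D: "csubspace D" "group_invariant \<alpha> D"
    and cont: "norm_continuous_group \<alpha>" and dom: "D \<subseteq> ext_dom euclidean \<alpha> z" and dense: "closure D = UNIV"
  shows "is_core euclidean euclidean \<alpha> z D"
proof -
  have orbit: "continuous_on UNIV (\<lambda>t. \<phi> (\<alpha> t x))" if "\<phi> \<in> cdual" for \<phi> :: "'e \<Rightarrow> complex" and x
    using cont bounded_linear.continuous_on[OF cdual_bounded_linear[OF that]]
    by (auto simp: norm_continuous_group_def)
  interpret dual_family \<alpha> euclidean cdual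
  proof
    fix \<phi> \<psi> :: "'e \<Rightarrow> complex" assume \<phi>: "\<phi> \<in> cdual" and \<psi>: "\<psi> \<in> cdual"
    show "(\<lambda>x. \<phi> x + \<psi> x) \<in> cdual"
      using \<phi> \<psi> by (auto simp: cdual_def clinear_def scaleC_complex_def distrib_left intro: bounded_linear_add)
  next
    fix \<phi> :: "'e \<Rightarrow> complex" and t assume \<phi>: "\<phi> \<in> cdual"
    show "continuous_map euclidean euclidean \<phi>"
      using linear_continuous_on[OF cdual_bounded_linear[OF \<phi>]] by simp
    show "(\<lambda>x. \<phi> (\<alpha> t x)) \<in> cdual"
      using \<phi> isometry_group_clinear[OF group, of t] isometry_group_bounded_linear[OF group, of t]
      by (auto simp: cdual_def clinear_def intro: bounded_linear_compose)
  next
    fix x y :: 'e assume *: "\<And>\<phi>. \<phi> \<in> cdual \<Longrightarrow> \<phi> x = \<phi> y"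
    obtain \<phi> where "\<phi> \<in> cdual" "\<phi> (x - y) = norm (x - y)" using cdual_norming by metis
    then show "x = y" using *[of \<phi>] clinear_diff[OF cdual_clinear, of \<phi>] by simp
  next
    fix \<phi> :: "'e \<Rightarrow> complex" and k :: "real \<Rightarrow> complex" and C
    assume "\<phi> \<in> cdual" "continuous_on UNIV k" "\<And>t. norm (k t) \<le> C * inverse (1 + t\<^sup>2)"
    then show "(\<lambda>x. \<integral>t. k t * \<phi> (\<alpha> t x) \<partial>lborel) \<in> cdual"
      by (intro smeared_cdual[OF group] orbit)
  qed (auto simp: group orbit)
  have "(x, group_ext euclidean \<alpha> z x) \<in> closure {(y, group_ext euclidean \<alpha> z y) | y. y \<in> D}"
    if x: "x \<in> ext_dom euclidean \<alpha> z" for x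
  proof (rule cdual_annihilator_closure[OF graph_csubspace[OF D(1) dom]])
    fix \<phi> :: "'e \<times> 'e \<Rightarrow> complex" assume \<phi>: "\<phi> \<in> cdual"
      and ann: "\<And>v. v \<in> {(y, group_ext euclidean \<alpha> z y) | y. y \<in> D} \<Longrightarrow> \<phi> v = 0"
    \<comment> \<open>A functional on E x E is a pair of functionals on E, which is the form that
      \<open>graph_annihilator\<close> handles.\<close>
    have split: "\<phi> (a, b) = \<phi> (a, 0) + \<phi> (0, b)" for a b
      using clinear_add[OF cdual_clinear[OF \<phi>], of "(a, 0)" "(0, b)"] by simp
    have bl: "bounded_linear (\<lambda>a::'e. (a, 0::'e))" "bounded_linear (\<lambda>a::'e. (0::'e, a))"
      by (intro bounded_linear_Pair bounded_linear_ident bounded_linear_zero)+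
    have cl: "clinear (\<lambda>a. \<phi> (a, 0))" "clinear (\<lambda>b. \<phi> (0, b))"
      unfolding clinear_def
      using clinear_add[OF cdual_clinear[OF \<phi>], of "(_, 0)" "(_, 0)"] clinear_add[OF cdual_clinear[OF \<phi>], of "(0, _)" "(0, _)"]
        clinear_scaleC[OF cdual_clinear[OF \<phi>], of _ "(_, 0)"] clinear_scaleC[OF cdual_clinear[OF \<phi>], of _ "(0, _)"]
      by (simp_all add: scaleC_prod_def scaleC_0)
    have parts: "(\<lambda>a. \<phi> (a, 0)) \<in> cdual" "(\<lambda>b. \<phi> (0, b)) \<in> cdual"
      using cl bounded_linear_compose[OF cdual_bounded_linear[OF \<phi>] bl(1)] bounded_linear_compose[OF cdual_bounded_linear[OF \<phi>] bl(2)]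
      unfolding cdual_def by blast+
    have "\<phi> (x, 0) + \<phi> (0, group_ext euclidean \<alpha> z x) = 0"
    proof (rule graph_annihilator[OF D(2) dom _ parts _ x])
      show "\<phi> (y, 0) + \<phi> (0, group_ext euclidean \<alpha> z y) = 0" if "y \<in> D" for y
        unfolding split[symmetric] using that by (intro ann) blast
      show "\<xi> v = 0" if "\<xi> \<in> cdual" "\<And>y. y \<in> D \<Longrightarrow> \<xi> y = 0" for \<xi> :: "'e \<Rightarrow> complex" and v
        by (rule continuous_constant_on_closure[of D \<xi>])
           (use that(2) linear_continuous_on[OF cdual_bounded_linear[OF that(1)]] in \<open>simp_all add: dense\<close>)
    qed
    then show "\<phi> (x, group_ext euclidean \<alpha> z x) = 0" by (rule trans[OF split])
  qed
  then show ?thesis using dom unfolding is_core_def ext_graph_def euclidean_closure_of by blast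
qed

subsection \<open>Weakly continuous groups of isometries\<close>

lemma bounded_bilinear_scaleC: "bounded_bilinear ((*\<^sub>C) :: complex \<Rightarrow> 'a::complex_banach \<Rightarrow> 'a)"
proof
  fix a :: complex and b :: 'a and r :: real
  show "(r *\<^sub>R a) *\<^sub>C b = r *\<^sub>R (a *\<^sub>C b)"
    using scaleC_scaleC[of "complex_of_real r" a b] by (simp only: scaleC_of_real scaleR_conv_of_real)
  have "a *\<^sub>C complex_of_real r *\<^sub>C b = complex_of_real r *\<^sub>C a *\<^sub>C b"
    by (simp only: scaleC_scaleC mult.commute)
  then show "a *\<^sub>C r *\<^sub>R b = r *\<^sub>R (a *\<^sub>C b)" by (simp only: scaleC_of_real)
  show "\<exists>K. \<forall>a b. norm ((a::complex) *\<^sub>C (b::'a)) \<le> norm a * norm b * K"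
    by (rule exI[of _ 1]) (simp add: norm_scaleC)
qed (simp_all add: scaleC_add_left scaleC_add_right)

lemmas continuous_on_scaleC = bounded_bilinear.continuous_on[OF bounded_bilinear_scaleC]

text \<open>C consists of the rational linear combinations of Q. Coding them as lists of
  coefficient-vector pairs makes countability immediate and addition a concatenation; real scalars
  are recovered in the closure by approximating them by rationals.\<close>

lemma separable_closure_span:
  fixes Q :: "'a::real_normed_vector set"
  assumes Q: "countable Q"
  obtains C where "countable C" "span Q \<subseteq> closure C"
proof -
  define comb where "comb l = (\<Sum>(r, q)\<leftarrow>l. r *\<^sub>R q)" for l :: "(real \<times> 'a) list"
  define C where "C = comb ` lists (\<rat> \<times> Q)"
  have "countable C"
    unfolding C_def using Q countable_rat by (intro countable_image countable_lists countable_SIGMA)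
  have C0: "0 \<in> C" unfolding C_def by (rule image_eqI[of _ _ "[]"]) (auto simp: comb_def)
  have CQ: "q \<in> C" if "q \<in> Q" for q
    unfolding C_def by (rule image_eqI[of _ _ "[(1, q)]"]) (use that in \<open>auto simp: comb_def\<close>)
  have Cadd: "x + y \<in> C" if xy: "x \<in> C" "y \<in> C" for x y
  proof -
    obtain l m where "l \<in> lists (\<rat> \<times> Q)" "m \<in> lists (\<rat> \<times> Q)" "x = comb l" "y = comb m"
      using xy unfolding C_def by blast
    then show ?thesis unfolding C_def by (intro image_eqI[of _ _ "l @ m"]) (auto simp: comb_def)
  qed
  have Cscale: "r *\<^sub>R x \<in> C" if r: "r \<in> \<rat>" and x: "x \<in> C" for r x
  proof -
    obtain l where l: "l \<in> lists (\<rat> \<times> Q)" "x = comb l" using x unfolding C_def by blast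
    have "r *\<^sub>R comb m = comb (map (\<lambda>(s, q). (r * s, q)) m)" for m
      by (induction m) (auto simp: comb_def scaleR_add_right)
    then show ?thesis
      unfolding C_def using l r
      by (intro image_eqI[of _ _ "map (\<lambda>(s, q). (r * s, q)) l"]) (auto simp: in_lists_conv_set)
  qed
  have "subspace (closure C)"
    unfolding subspace_def
  proof (intro conjI ballI allI)
    show "0 \<in> closure C" using C0 closure_subset by blast
  next
    fix x y assume "x \<in> closure C" "y \<in> closure C"
    then obtain f g where "\<And>n. f n \<in> C" "f \<longlonglongrightarrow> x" "\<And>n. g n \<in> C" "g \<longlonglongrightarrow> y"
      by (auto simp: closure_sequential)
    then have "(\<lambda>n. f n + g n) \<longlonglongrightarrow> x + y" "\<And>n. f n + g n \<in> C" by (auto intro: tendsto_add Cadd)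
    then show "x + y \<in> closure C" unfolding closure_sequential by (intro exI[of _ "\<lambda>n. f n + g n"]) simp
  next
    fix c :: real and x assume "x \<in> closure C"
    then obtain f where f: "\<And>n. f n \<in> C" "f \<longlonglongrightarrow> x" by (auto simp: closure_sequential)
    have "c \<in> closure \<rat>" by (simp add: Rats_closure_real)
    then obtain r where r: "\<And>n. r n \<in> \<rat>" "r \<longlonglongrightarrow> c" by (auto simp: closure_sequential)
    have "(\<lambda>n. r n *\<^sub>R f n) \<longlonglongrightarrow> c *\<^sub>R x" using f r by (intro tendsto_scaleR)
    moreover have "r n *\<^sub>R f n \<in> C" for n using f r by (intro Cscale)
    ultimately show "c *\<^sub>R x \<in> closure C" unfolding closure_sequential by (intro exI[of _ "\<lambda>n. r n *\<^sub>R f n"]) simp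
  qed
  moreover have "Q \<subseteq> closure C" using CQ closure_subset by blast
  ultimately have "span Q \<subseteq> closure C" by (intro span_minimal)
  with \<open>countable C\<close> show ?thesis by (rule that)
qed

text \<open>A weakly continuous orbit lies in the closed span of its values at rational times, so it is
  covered by countably many balls of any given radius. Balls are weakly closed, so Baire's theorem
  provides an interval of times on which the orbit stays within one of them.\<close>

lemma weakly_continuous_isometry_group:
  fixes \<beta> :: "real \<Rightarrow> 'p::complex_banach \<Rightarrow> 'p"
  assumes group: "isometry_group \<beta>"
    and weak: "\<And>\<phi>. \<phi> \<in> cdual \<Longrightarrow> continuous_on UNIV (\<lambda>t. \<phi> (\<beta> t p))"
  shows "continuous_on UNIV (\<lambda>t. \<beta> t p)"
proof -
  obtain C where C: "countable C" "span ((\<lambda>t. \<beta> t p) ` \<rat>) \<subseteq> closure C"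
    by (rule separable_closure_span[OF countable_image[OF countable_rat]])
  \<comment> \<open>A functional separating \<open>\<beta> t p\<close> from the span would have a
    real part that is continuous in time along the orbit and 0 at all rational times.\<close>
  have "\<beta> t p \<in> closure (span ((\<lambda>t. \<beta> t p) ` \<rat>))" for t
  proof (rule ccontr)
    assume "\<beta> t p \<notin> closure (span ((\<lambda>t. \<beta> t p) ` \<rat>))"
    then obtain \<phi> where \<phi>: "\<phi> \<in> cdual" "\<And>x. x \<in> span ((\<lambda>t. \<beta> t p) ` \<rat>) \<Longrightarrow> Re (\<phi> x) = 0" "Re (\<phi> (\<beta> t p)) > 0"
      using cdual_separates_closed_subspace[OF subspace_span] by blast
    have "Re (\<phi> (\<beta> t p)) = 0"
    proof (rule continuous_constant_on_closure[of "\<rat>" "\<lambda>t. Re (\<phi> (\<beta> t p))"])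
      show "continuous_on (closure \<rat>) (\<lambda>t. Re (\<phi> (\<beta> t p)))"
        using weak[OF \<phi>(1)] by (intro continuous_on_Re) (simp add: Rats_closure_real)
      show "Re (\<phi> (\<beta> s p)) = 0" if "s \<in> \<rat>" for s
        using that by (intro \<phi>(2) span_base) blast
      show "t \<in> closure \<rat>" by (simp add: Rats_closure_real)
    qed
    then show False using \<phi>(3) by simp
  qed
  then have dense: "\<beta> t p \<in> closure C" for t
    using closure_mono[OF C(2)] by auto
  have step: "\<exists>\<delta>>0. \<forall>h. \<bar>h\<bar> < \<delta> \<longrightarrow> (\<forall>s. norm (\<beta> (s + h) p - \<beta> s p) \<le> 2 * e)" if e: "0 < e" for e
  proof -
    define A where "A c = {t. norm (\<beta> t p - c) \<le> e}" for c
    have closed: "closed (A c)" for c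
    proof -
      \<comment> \<open>By norming functionals, a closed ball is an intersection of sets cut out by
        single functionals; each is closed in t by weak continuity.\<close>
      have "A c = (\<Inter>\<phi>\<in>{\<phi>\<in>cdual. \<forall>v. norm (\<phi> v) \<le> norm v}. {t. norm (\<phi> (\<beta> t p) - \<phi> c) \<le> e})" (is "_ = ?I")
      proof
        show "A c \<subseteq> ?I"
        proof (clarsimp simp: A_def)
          fix t and \<phi> :: "'p \<Rightarrow> complex"
          assume t: "norm (\<beta> t p - c) \<le> e" and \<phi>: "\<phi> \<in> cdual" "\<forall>v. norm (\<phi> v) \<le> norm v"
          show "norm (\<phi> (\<beta> t p) - \<phi> c) \<le> e"
            using t \<phi>(2) clinear_diff[OF cdual_clinear[OF \<phi>(1)]] by (metis order_trans)
        qed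
        show "?I \<subseteq> A c"
        proof
          fix t assume t: "t \<in> ?I"
          obtain \<phi> where \<phi>: "\<phi> \<in> cdual" "\<And>x. norm (\<phi> x) \<le> norm x" "\<phi> (\<beta> t p - c) = norm (\<beta> t p - c)"
            using cdual_norming by metis
          then have "norm (\<phi> (\<beta> t p) - \<phi> c) \<le> e" using t by blast
          then have "norm (\<phi> (\<beta> t p - c)) \<le> e" using clinear_diff[OF cdual_clinear[OF \<phi>(1)]] by simp
          then show "t \<in> A c" by (simp add: A_def \<phi>(3))
        qed
      qed
      moreover have "closed {t. norm (\<phi> (\<beta> t p) - \<phi> c) \<le> e}" if "\<phi> \<in> cdual" for \<phi>
        by (intro closed_Collect_le continuous_intros weak[OF that])
      ultimately show ?thesis by (auto intro!: closed_INT)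
    qed
    have "\<exists>c\<in>C. interior (A c) \<noteq> {}"
    proof (rule ccontr)
      assume "\<not> (\<exists>c\<in>C. interior (A c) \<noteq> {})"
      then have "euclideanreal interior_of \<Union> (A ` C) = {}"
        using closed C(1)
        by (intro Baire_category_alt) (auto simp: completely_metrizable_space_euclidean)
      moreover have "\<Union> (A ` C) = UNIV"
      proof -
        have "\<exists>c\<in>C. t \<in> A c" for t
          using dense[of t] e unfolding closure_approachable A_def
          by (metis (mono_tags, lifting) dist_commute dist_norm less_imp_le mem_Collect_eq)
        then show ?thesis by auto
      qed
      ultimately show False by simp
    qed
    then obtain c t0 where "t0 \<in> interior (A c)" by blast
    then obtain \<delta> where \<delta>: "\<delta> > 0" "ball t0 \<delta> \<subseteq> A c" by (auto simp: mem_interior)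
    have "norm (\<beta> (s + h) p - \<beta> s p) \<le> 2 * e" if h: "\<bar>h\<bar> < \<delta>" for s h
    proof -
      have "t0 + h \<in> A c" "t0 \<in> A c" using \<delta> h by (auto simp: dist_real_def subset_iff)
      then have "norm (\<beta> (t0 + h) p - \<beta> t0 p) \<le> 2 * e"
        using norm_triangle_ineq4[of "\<beta> (t0 + h) p - c" "\<beta> t0 p - c"] by (simp add: A_def)
      \<comment> \<open>The contraction \<open>\<beta> (s - t0)\<close> carries the estimate from t0
        to any s, so one interval found by Baire gives a uniform modulus of continuity.\<close>
      moreover have "\<beta> (s + h) p - \<beta> s p = \<beta> (s - t0) (\<beta> (t0 + h) p - \<beta> t0 p)"
        by (simp add: clinear_diff isometry_group_clinear[OF group] isometry_group_add[OF group])
      ultimately show ?thesis using isometry_group_norm_le[OF group] by (metis order_trans)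
    qed
    then show ?thesis using \<delta>(1) by blast
  qed
  show ?thesis
    unfolding continuous_on_iff
  proof (intro ballI allI impI)
    fix s e :: real assume "0 < e"
    \<comment> \<open>One third, because 2 * (e / 3) is strictly less than e.\<close>
    then obtain \<delta> where \<delta>: "\<delta> > 0" "\<And>h s. \<bar>h\<bar> < \<delta> \<Longrightarrow> norm (\<beta> (s + h) p - \<beta> s p) \<le> 2 * (e / 3)"
      using step[of "e / 3"] by auto
    have "dist (\<beta> t p) (\<beta> s p) < e" if "dist t s < \<delta>" for t
      using \<delta>(2)[of "t - s" s] that \<open>0 < e\<close> by (simp add: dist_norm)
    then show "\<exists>\<delta>>0. \<forall>t\<in>UNIV. dist t s < \<delta> \<longrightarrow> dist (\<beta> t p) (\<beta> s p) < e" using \<delta>(1) by blast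
  qed
qed

subsection \<open>The weak-star topology\<close>

lemma weak_star_openin_Basis: "open U \<Longrightarrow> openin (weak_star B) {x. B x p \<in> U}"
  unfolding weak_star_def by (intro topology_generated_by_Basis) blast

lemma topspace_weak_star: "topspace (weak_star B) = UNIV"
proof -
  have "{x. B x p \<in> UNIV} \<in> {{x. B x p \<in> U} | p U. open U}" for p by blast
  then show ?thesis unfolding weak_star_def topology_generated_by_topspace by blast
qed

lemma continuous_map_weak_star_pairing: "continuous_map (weak_star B) euclidean (\<lambda>x. B x p)"
  unfolding continuous_map_def topspace_weak_star by (simp add: weak_star_openin_Basis)

text \<open>Exact agreement with v on finitely many p replaces the usual epsilon-neighbourhoods; it
  is enough because a subspace can interpolate v exactly.\<close>

lemma weak_star_nbhd_finite:
  assumes "openin (weak_star B) W" "v \<in> W"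
  obtains P where "finite P" "\<And>u. (\<And>p. p \<in> P \<Longrightarrow> B u p = B v p) \<Longrightarrow> u \<in> W"
proof -
  have "generate_topology_on {{x. B x p \<in> U} | p U. open U} W"
    using assms(1) unfolding weak_star_def by (rule openin_topology_generated_by)
  then have "v \<in> W \<Longrightarrow> \<exists>P. finite P \<and> (\<forall>u. (\<forall>p\<in>P. B u p = B v p) \<longrightarrow> u \<in> W)"
  proof induction
    case Empty
    then show ?case by simp
  next
    case (Int a b)
    then obtain P Q where "finite P" "\<forall>u. (\<forall>p\<in>P. B u p = B v p) \<longrightarrow> u \<in> a"
      "finite Q" "\<forall>u. (\<forall>p\<in>Q. B u p = B v p) \<longrightarrow> u \<in> b" by auto
    then show ?case by (intro exI[of _ "P \<union> Q"]) auto
  next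
    case (UN K)
    then obtain k where "k \<in> K" "v \<in> k" by blast
    with UN.IH show ?case by (meson UnionI)
  next
    case (Basis s)
    then obtain p U where "s = {x. B x p \<in> U}" by blast
    then show ?case using Basis by (intro exI[of _ "{p}"]) auto
  qed
  then show ?thesis using assms(2) that by blast
qed

text \<open>The finite-dimensional core of the bipolar theorem for subspaces. To add a point p not
  annihilated by V, normalise some u0 in V to have value 1 at p, and pass to the kernel V' of
  evaluation at p in V and to the correction v' of v by a multiple of u0. If q annihilates V', then
  q - (\<open>B u0 q\<close>) p annihilates V, so the hypothesis is inherited.\<close>

lemma annihilator_interpolation:
  fixes B :: "'v::complex_banach \<Rightarrow> 'q::complex_banach \<Rightarrow> complex"
  assumes lin1: "\<And>q. clinear (\<lambda>u. B u q)" and lin2: "\<And>u. clinear (B u)"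
  shows "finite P \<Longrightarrow> csubspace V \<Longrightarrow> (\<And>q. (\<And>u. u \<in> V \<Longrightarrow> B u q = 0) \<Longrightarrow> B v q = 0)
    \<Longrightarrow> \<exists>u\<in>V. \<forall>p\<in>P. B u p = B v p"
proof (induction P arbitrary: V v rule: finite_induct)
  case empty
  then show ?case by (auto simp: csubspace_def)
next
  case (insert p P)
  note lin = clinear_add[OF lin1] clinear_scaleC[OF lin1] clinear_diff[OF lin1]
    clinear_add[OF lin2] clinear_scaleC[OF lin2] clinear_diff[OF lin2] scaleC_complex_def
  have V0: "0 \<in> V" and Vadd: "\<And>x y. x \<in> V \<Longrightarrow> y \<in> V \<Longrightarrow> x + y \<in> V"
    and Vscale: "\<And>c x. x \<in> V \<Longrightarrow> c *\<^sub>C x \<in> V"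
    using insert.prems(1) by (auto simp: csubspace_def)
  show ?case
  proof (cases "\<forall>u\<in>V. B u p = 0")
    case True
    then have "B v p = 0" using insert.prems(2) by blast
    then show ?thesis using insert.IH[OF insert.prems] True by auto
  next
    case False
    then obtain w where w: "w \<in> V" "B w p \<noteq> 0" by blast
    define u0 where "u0 = inverse (B w p) *\<^sub>C w"
    have u0: "u0 \<in> V" "B u0 p = 1" using w by (auto simp: u0_def Vscale lin)
    define V' where "V' = {u\<in>V. B u p = 0}"
    define v' where "v' = v - B v p *\<^sub>C u0"
    have "csubspace V'"
      using V0 Vadd Vscale clinear_0[OF lin1] by (auto simp: csubspace_def V'_def lin)
    moreover have "B v' q = 0" if q: "\<And>u. u \<in> V' \<Longrightarrow> B u q = 0" for q
    proof -
      have "B u (q - B u0 q *\<^sub>C p) = 0" if u: "u \<in> V" for u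
      proof -
        have "u + (- B u p) *\<^sub>C u0 \<in> V'" using u u0 Vadd Vscale by (auto simp: V'_def lin)
        then have "B (u + (- B u p) *\<^sub>C u0) q = 0" by (rule q)
        then show ?thesis by (simp add: lin mult.commute)
      qed
      then have "B v (q - B u0 q *\<^sub>C p) = 0" by (rule insert.prems(2))
      then show ?thesis by (simp add: v'_def lin mult.commute)
    qed
    ultimately obtain u' where u': "u' \<in> V'" "\<forall>p\<in>P. B u' p = B v' p"
      using insert.IH[of V' v'] by blast
    have "u' + B v p *\<^sub>C u0 \<in> V" using u' u0 Vadd Vscale by (auto simp: V'_def)
    moreover have "B (u' + B v p *\<^sub>C u0) p' = B v p'" if "p' \<in> insert p P" for p'
      using that u' u0 by (auto simp: lin V'_def v'_def)
    ultimately show ?thesis by blast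
  qed
qed

lemma weak_star_annihilator_closure:
  fixes B :: "'v::complex_banach \<Rightarrow> 'q::complex_banach \<Rightarrow> complex"
  assumes "\<And>q. clinear (\<lambda>u. B u q)" "\<And>u. clinear (B u)" "csubspace V"
    and "\<And>q. (\<And>u. u \<in> V \<Longrightarrow> B u q = 0) \<Longrightarrow> B v q = 0"
  shows "v \<in> weak_star B closure_of V"
  unfolding in_closure_of
proof (intro conjI allI impI)
  fix W assume W: "v \<in> W \<and> openin (weak_star B) W"
  then obtain P where P: "finite P" "\<And>u. (\<And>p. p \<in> P \<Longrightarrow> B u p = B v p) \<Longrightarrow> u \<in> W"
    using weak_star_nbhd_finite by metis
  obtain u where "u \<in> V" "\<forall>p\<in>P. B u p = B v p"
    using annihilator_interpolation[OF assms(1,2) P(1) assms(3,4)] by blast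
  then show "\<exists>y. y \<in> V \<and> y \<in> W" using P(2) by blast
qed (simp add: topspace_weak_star)

text \<open>A functional vanishing on the common kernel of finitely many evaluations is a
  combination of them, hence again an evaluation. The induction removes p by subtracting from L its
  component along evaluation at p, read off at a vector x0 dual to p.\<close>

lemma clinear_finite_kernel:
  fixes B :: "'v::complex_banach \<Rightarrow> 'q::complex_banach \<Rightarrow> complex"
  assumes lin1: "\<And>q. clinear (\<lambda>u. B u q)" and lin2: "\<And>u. clinear (B u)"
  shows "finite P \<Longrightarrow> clinear L \<Longrightarrow> (\<And>x. (\<And>p. p \<in> P \<Longrightarrow> B x p = 0) \<Longrightarrow> L x = 0)
    \<Longrightarrow> \<exists>q. \<forall>x. L x = B x q"
proof (induction P arbitrary: L rule: finite_induct)
  case empty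
  then have "\<forall>x. L x = B x 0" using clinear_0[OF lin2] by simp
  then show ?case by blast
next
  case (insert p P)
  note lin = clinear_add[OF lin1] clinear_scaleC[OF lin1] clinear_diff[OF lin1]
    clinear_add[OF lin2] clinear_scaleC[OF lin2] clinear_diff[OF lin2] scaleC_complex_def
  note linL = clinear_add[OF insert.prems(1)] clinear_scaleC[OF insert.prems(1)] clinear_diff[OF insert.prems(1)]
  show ?case
  proof (cases "\<forall>x. (\<forall>p\<in>P. B x p = 0) \<longrightarrow> L x = 0")
    case True
    then show ?thesis using insert.IH[OF insert.prems(1)] by blast
  next
    case False
    then obtain y where y: "\<And>p. p \<in> P \<Longrightarrow> B y p = 0" "L y \<noteq> 0" by blast
    then have yp: "B y p \<noteq> 0" using insert.prems(2)[of y] by auto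
    define x0 where "x0 = inverse (B y p) *\<^sub>C y"
    have x0: "\<And>p. p \<in> P \<Longrightarrow> B x0 p = 0" "B x0 p = 1" using y yp by (auto simp: x0_def lin)
    have "clinear (\<lambda>x. L x - L x0 * B x p)"
      unfolding clinear_def by (simp add: linL lin algebra_simps)
    moreover have "L x - L x0 * B x p = 0" if "\<And>p. p \<in> P \<Longrightarrow> B x p = 0" for x
    proof -
      have "L (x - B x p *\<^sub>C x0) = 0"
        by (rule insert.prems(2)) (use that x0 in \<open>auto simp: lin\<close>)
      then show ?thesis by (simp add: linL scaleC_complex_def mult.commute)
    qed
    ultimately obtain q where q: "\<forall>x. L x - L x0 * B x p = B x q"
      using insert.IH[of "\<lambda>x. L x - L x0 * B x p"] by blast
    have "L x = B x (q + L x0 *\<^sub>C p)" for x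
      using spec[OF q, of x] by (simp add: lin diff_eq_eq)
    then show ?thesis by blast
  qed
qed

text \<open>By continuity, L maps some common kernel of finitely many evaluations into the open unit
  disc. This kernel is a subspace, and rescaling a vector with L x nonzero to the value 1 would
  leave the disc, so L vanishes on it.\<close>

lemma weak_star_continuous_functional:
  fixes B :: "'v::complex_banach \<Rightarrow> 'q::complex_banach \<Rightarrow> complex"
  assumes lin1: "\<And>q. clinear (\<lambda>u. B u q)" and lin2: "\<And>u. clinear (B u)"
    and L: "clinear L" and cont: "continuous_map (weak_star B) euclidean L"
  obtains q where "\<And>x. L x = B x q"
proof -
  have "openin (weak_star B) {x. L x \<in> ball 0 1}"
    using openin_continuous_map_preimage[OF cont, of "ball 0 1"] by (simp add: topspace_weak_star)
  moreover have "0 \<in> {x. L x \<in> ball 0 1}" by (simp add: clinear_0[OF L])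
  ultimately obtain P where P: "finite P" "\<And>u. (\<And>p. p \<in> P \<Longrightarrow> B u p = B 0 p) \<Longrightarrow> u \<in> {x. L x \<in> ball 0 1}"
    by (rule weak_star_nbhd_finite) blast
  have "L x = 0" if x: "\<And>p. p \<in> P \<Longrightarrow> B x p = 0" for x
  proof (rule ccontr)
    assume Lx: "L x \<noteq> 0"
    have "inverse (L x) *\<^sub>C x \<in> {x. L x \<in> ball 0 1}"
      by (rule P(2)) (simp add: x clinear_scaleC[OF lin1] clinear_0[OF lin1] scaleC_complex_def)
    then show False using Lx by (simp add: clinear_scaleC[OF L] scaleC_complex_def)
  qed
  then show ?thesis using clinear_finite_kernel[OF lin1 lin2 P(1) L] that by blast
qed

section \<open>Dual Banach spaces and the weak-star continuous case\<close>

locale predual =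
  fixes B :: "'e::complex_banach \<Rightarrow> 'p::complex_banach \<Rightarrow> complex"
  assumes predual: "is_predual B"
begin

lemma pairing_cdual: "B x \<in> cdual"
  using predual by (auto simp: is_predual_def bij_betw_def)

lemma pairing_surj:
  assumes "\<phi> \<in> cdual" obtains x where "B x = \<phi>"
proof -
  have "\<phi> \<in> range B" using predual assms by (simp add: is_predual_def bij_betw_def)
  then show ?thesis using that by blast
qed

lemma pairing_eqI:
  assumes "\<And>p. B x p = B y p" shows "x = y"
proof -
  have "B x = B y" using assms by blast
  then show ?thesis using predual by (auto simp: is_predual_def bij_betw_def inj_def)
qed

lemma clinear_left: "clinear (\<lambda>x. B x p)"
  using predual by (simp add: is_predual_def)

lemma clinear_right: "clinear (B x)"
  by (rule cdual_clinear[OF pairing_cdual])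

lemma pairing_le: "norm (B x p) \<le> norm x * norm p"
  using onorm[OF cdual_bounded_linear[OF pairing_cdual], of x p] predual by (simp add: is_predual_def)

lemma pairing_left_cdual: "(\<lambda>x. B x p) \<in> cdual"
  using bounded_linear_clinearI[OF clinear_left pairing_le] clinear_left by (simp add: cdual_def)

text \<open>A norming functional of p is \<open>B x\<close> for some x, since B is onto the dual of
  the predual, and its operator norm is the norm of x.\<close>

lemma pairing_norming:
  obtains x where "norm x \<le> 1" "B x p = norm p"
proof -
  obtain \<phi> where \<phi>: "\<phi> \<in> cdual" "\<And>v. norm (\<phi> v) \<le> norm v" "\<phi> p = norm p" using cdual_norming by metis
  obtain x where x: "B x = \<phi>" by (rule pairing_surj[OF \<phi>(1)])
  have "onorm \<phi> \<le> 1" using \<phi>(2) by (intro onorm_bound) auto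
  then have "norm x \<le> 1" using predual by (simp add: is_predual_def flip: x)
  then show ?thesis using that x \<phi>(3) by auto
qed

lemma predual_eqI:
  assumes "\<And>x. B x p = B x q" shows "p = q"
proof -
  obtain x where "B x (p - q) = norm (p - q)" using pairing_norming by blast
  then show ?thesis using assms clinear_diff[OF clinear_right] by simp
qed

text \<open>Evaluation at p composed with \<open>\<alpha> t\<close> is weak-star continuous, hence
  evaluation at a point, named \<open>\<beta> t p\<close>. Its algebraic properties follow by
  pairing with all x. Every functional on the predual is some \<open>B x\<close>, so weak-star
  continuity of the orbits of \<alpha> is exactly weak continuity of those of \<beta>.\<close>

lemma preadjoint_group:
  assumes group: "isometry_group \<alpha>" and cont: "weak_star_continuous_group B \<alpha>"
  obtains \<beta> where "isometry_group \<beta>" "\<And>t x p. B x (\<beta> t p) = B (\<alpha> t x) p" "\<And>p. continuous_on UNIV (\<lambda>t. \<beta> t p)"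
proof -
  have "\<exists>q. \<forall>x. B (\<alpha> t x) p = B x q" for t p
  proof -
    have c: "continuous_map (weak_star B) euclidean ((\<lambda>x. B x p) \<circ> \<alpha> t)"
      using cont continuous_map_weak_star_pairing
      by (intro continuous_map_compose) (auto simp: weak_star_continuous_group_def)
    have l: "clinear ((\<lambda>x. B x p) \<circ> \<alpha> t)"
      using clinear_left[of p] isometry_group_clinear[OF group, of t] by (simp add: clinear_def)
    obtain q where "\<And>x. ((\<lambda>x. B x p) \<circ> \<alpha> t) x = B x q"
      using weak_star_continuous_functional[OF clinear_left clinear_right l c] by blast
    then show ?thesis by auto
  qed
  then have "\<exists>\<beta>. \<forall>t p x. B (\<alpha> t x) p = B x (\<beta> t p)" by (intro choice allI)
  then obtain \<beta> where \<beta>: "\<And>t x p. B x (\<beta> t p) = B (\<alpha> t x) p" by auto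
  have gr: "isometry_group \<beta>"
    unfolding isometry_group_def
  proof (intro conjI allI)
    fix t s
    show "clinear (\<beta> t)"
      unfolding clinear_def
    proof (intro conjI allI; rule predual_eqI)
      show "B x (\<beta> t (p + q)) = B x (\<beta> t p + \<beta> t q)" for p q x
        by (simp add: \<beta> clinear_add[OF clinear_right])
      show "B x (\<beta> t (c *\<^sub>C p)) = B x (c *\<^sub>C \<beta> t p)" for c p x
        by (simp add: \<beta> clinear_scaleC[OF clinear_right])
    qed
    show "norm (\<beta> t p) \<le> norm p" for p
    proof -
      obtain x where x: "norm x \<le> 1" "B x (\<beta> t p) = norm (\<beta> t p)" by (rule pairing_norming)
      have "norm (\<beta> t p) = norm (B (\<alpha> t x) p)" using x(2) \<beta>[of x t p] by simp
      also have "\<dots> \<le> norm (\<alpha> t x) * norm p" by (rule pairing_le)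
      also have "\<dots> \<le> 1 * norm p"
        using isometry_group_norm_le[OF group, of t x] x(1) by (intro mult_right_mono) auto
      finally show ?thesis by simp
    qed
    show "\<beta> 0 = id"
      by (rule ext, rule predual_eqI) (simp add: \<beta> isometry_group_0[OF group])
    show "\<beta> t \<circ> \<beta> s = \<beta> (t + s)"
      \<comment> \<open>Preadjoints compose in the opposite order, which is harmless because
        addition of times is commutative.\<close>
      by (rule ext, rule predual_eqI) (simp add: \<beta> isometry_group_add[OF group] add.commute)
  qed
  have orbit: "continuous_on UNIV (\<lambda>t. B (\<alpha> t x) p)" for x p
  proof -
    have "continuous_map euclidean euclidean ((\<lambda>x. B x p) \<circ> (\<lambda>t. \<alpha> t x))"
      using cont continuous_map_weak_star_pairing
      by (intro continuous_map_compose) (auto simp: weak_star_continuous_group_def)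
    then show ?thesis by (simp add: o_def)
  qed
  have "continuous_on UNIV (\<lambda>t. \<beta> t p)" for p
  proof (rule weakly_continuous_isometry_group[OF gr])
    fix \<phi> :: "'p \<Rightarrow> complex" assume "\<phi> \<in> cdual"
    then obtain x where x: "B x = \<phi>" by (rule pairing_surj)
    show "continuous_on UNIV (\<lambda>t. \<phi> (\<beta> t p))" unfolding x[symmetric] \<beta> by (rule orbit)
  qed
  then show ?thesis using that gr \<beta> by blast
qed

lemma weak_star_dual_family:
  assumes group: "isometry_group \<alpha>" and cont: "weak_star_continuous_group B \<alpha>"
  shows "dual_family \<alpha> (weak_star B) (range (\<lambda>p x. B x p))"
proof -
  obtain \<beta> where \<beta>: "isometry_group \<beta>" "\<And>t x p. B x (\<beta> t p) = B (\<alpha> t x) p" "\<And>p. continuous_on UNIV (\<lambda>t. \<beta> t p)"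
    using preadjoint_group[OF assms] by metis
  show ?thesis
  proof
    fix \<phi> :: "'e \<Rightarrow> complex" and t assume "\<phi> \<in> range (\<lambda>p x. B x p)"
    then obtain p where p: "\<phi> = (\<lambda>x. B x p)" by blast
    show "continuous_map (weak_star B) euclidean \<phi>" unfolding p by (rule continuous_map_weak_star_pairing)
    show "(\<lambda>x. \<phi> (\<alpha> t x)) \<in> range (\<lambda>p x. B x p)" unfolding p \<beta>(2)[symmetric] by blast
    show "continuous_on UNIV (\<lambda>t. \<phi> (\<alpha> t x))" for x
      unfolding p \<beta>(2)[symmetric]
      by (rule bounded_linear.continuous_on[OF cdual_bounded_linear[OF pairing_cdual] \<beta>(3)])
    fix k :: "real \<Rightarrow> complex" and C
    assume k: "continuous_on UNIV k" "\<And>t. norm (k t) \<le> C * inverse (1 + t\<^sup>2)"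
    define F where "F t = k t *\<^sub>C \<beta> t p" for t
    have F: "continuous_on UNIV F" unfolding F_def by (intro continuous_on_scaleC k \<beta>)
    have F_le: "norm (F t) \<le> (C * norm p) * inverse (1 + t\<^sup>2)" for t
    proof -
      have "norm (F t) \<le> (C * inverse (1 + t\<^sup>2)) * norm p"
        unfolding F_def norm_scaleC
        by (intro mult_mono k isometry_group_norm_le[OF \<beta>(1)] order_trans[OF norm_ge_zero k(2)] norm_ge_zero)
      then show ?thesis by (simp add: mult_ac)
    qed
    \<comment> \<open>The point q is the predual-valued integral of
      \<open>k t *\<^sub>C \<beta> t p\<close>. It represents the smeared functional because
      \<open>B x\<close> commutes with each truncated integral and with the limit.\<close>
    obtain q where q: "(\<lambda>n. integral {- real n..real n} F) \<longlonglongrightarrow> q"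
      using convergent_integral_symmetric[OF F F_le] by (auto simp: convergent_def)
    have "B x q = (\<integral>t. k t * \<phi> (\<alpha> t x) \<partial>lborel)" for x
    proof (rule LIMSEQ_unique)
      have BF: "B x (F t) = k t * \<phi> (\<alpha> t x)" for t
        by (simp add: F_def clinear_scaleC[OF clinear_right] scaleC_complex_def \<beta>(2) p)
      have bl: "bounded_linear (B x)" by (rule cdual_bounded_linear[OF pairing_cdual])
      have "B x (integral {- real n..real n} F) = integral {- real n..real n} (\<lambda>t. k t * \<phi> (\<alpha> t x))" for n
        using integral_linear[OF integrable_continuous_interval[OF continuous_on_subset[OF F]] bl, of "- real n" "real n"]
        by (simp add: o_def BF)
      then show "(\<lambda>n. integral {- real n..real n} (\<lambda>t. k t * \<phi> (\<alpha> t x))) \<longlonglongrightarrow> B x q"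
        using bounded_linear.tendsto[OF bl q] by simp
      have "norm (B x (F t)) \<le> (norm x * (C * norm p)) * inverse (1 + t\<^sup>2)" for t
        using order_trans[OF pairing_le mult_left_mono[OF F_le norm_ge_zero]] by (simp add: mult.assoc)
      then show "(\<lambda>n. integral {- real n..real n} (\<lambda>t. k t * \<phi> (\<alpha> t x))) \<longlonglongrightarrow> (\<integral>t. k t * \<phi> (\<alpha> t x) \<partial>lborel)"
        unfolding BF[symmetric]
        by (intro tendsto_integral_symmetric bounded_linear.continuous_on[OF bl F])
    qed
    then show "(\<lambda>x. \<integral>t. k t * \<phi> (\<alpha> t x) \<partial>lborel) \<in> range (\<lambda>p x. B x p)"
      by (intro range_eqI[of _ _ q] ext) simp
  next
    fix \<phi> \<psi> assume "\<phi> \<in> range (\<lambda>p x. B x p)" "\<psi> \<in> range (\<lambda>p x. B x p)"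
    then obtain p q where "\<phi> = (\<lambda>x. B x p)" "\<psi> = (\<lambda>x. B x q)" by blast
    then show "(\<lambda>x. \<phi> x + \<psi> x) \<in> range (\<lambda>p x. B x p)"
      by (intro range_eqI[of _ _ "p + q"] ext) (simp add: clinear_add[OF clinear_right])
  next
    fix x y assume "\<And>\<phi>. \<phi> \<in> range (\<lambda>p x. B x p) \<Longrightarrow> \<phi> x = \<phi> y"
    then show "x = y" by (intro pairing_eqI) blast
  next
    show "range (\<lambda>p x. B x p) \<subseteq> cdual" using pairing_left_cdual by blast
  qed (rule group)
qed

lemma sum_pairing_eq: "sum_pairing B u q = B (fst u) (fst q) + B (snd u) (snd q)"
  by (simp add: sum_pairing_def split_beta)

lemma is_core_weak_star_dense:
  assumes group: "isometry_group \<alpha>" and D: "csubspace D" "group_invariant \<alpha> D"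
    and cont: "weak_star_continuous_group B \<alpha>" and dom: "D \<subseteq> ext_dom (weak_star B) \<alpha> z"
    and dense: "weak_star B closure_of D = UNIV"
  shows "is_core (weak_star B) (weak_star (sum_pairing B)) \<alpha> z D"
proof -
  interpret dual_family \<alpha> "weak_star B" "range (\<lambda>p x. B x p)"
    by (rule weak_star_dual_family[OF group cont])
  let ?A = "group_ext (weak_star B) \<alpha> z"
  have "(x, ?A x) \<in> weak_star (sum_pairing B) closure_of {(y, ?A y) | y. y \<in> D}"
    if x: "x \<in> ext_dom (weak_star B) \<alpha> z" for x
  proof (rule weak_star_annihilator_closure)
    show "clinear (\<lambda>u. sum_pairing B u q)" for q
      unfolding clinear_def
      by (simp add: sum_pairing_eq scaleC_prod_def clinear_add[OF clinear_left] clinear_scaleC[OF clinear_left]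
          scaleC_add_right)
    show "clinear (sum_pairing B u)" for u
      unfolding clinear_def
      by (simp add: sum_pairing_eq scaleC_prod_def clinear_add[OF clinear_right] clinear_scaleC[OF clinear_right]
          scaleC_add_right)
    show "csubspace {(y, ?A y) | y. y \<in> D}" by (rule graph_csubspace[OF D(1) dom])
    fix v :: "'p \<times> 'p" assume ann: "\<And>u. u \<in> {(y, ?A y) | y. y \<in> D} \<Longrightarrow> sum_pairing B u v = 0"
    obtain p q where v: "v = (p, q)" by (cases v)
    have "(\<lambda>x. B x p) \<in> range (\<lambda>p x. B x p)" "(\<lambda>x. B x q) \<in> range (\<lambda>p x. B x p)" by blast+
    note ann' = graph_annihilator[OF D(2) dom _ this _ x]
    have "B x p + B (?A x) q = 0"
    proof (rule ann')
      show "B y p + B (?A y) q = 0" if "y \<in> D" for y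
      proof -
        have "sum_pairing B (y, ?A y) v = 0" using that by (intro ann) blast
        then show ?thesis by (simp add: sum_pairing_def v)
      qed
      fix \<xi> w assume \<xi>: "\<xi> \<in> range (\<lambda>p x. B x p)" and zero: "\<And>y. y \<in> D \<Longrightarrow> \<xi> y = 0"
      obtain r where r: "\<xi> = (\<lambda>x. B x r)" using \<xi> by blast
      \<comment> \<open>Zero sets of evaluations are weak-star closed, so an evaluation vanishing on
        the weak-star dense \<open>D\<close> vanishes everywhere.\<close>
      have "closedin (weak_star B) {x. B x r = 0}"
        using closedin_continuous_map_preimage[OF continuous_map_weak_star_pairing, of "{0}" B r]
        by (simp add: topspace_weak_star)
      moreover have "D \<subseteq> {x. B x r = 0}" using zero unfolding r by blast
      ultimately have "weak_star B closure_of D \<subseteq> {x. B x r = 0}" by (rule closure_of_minimal[rotated])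
      then show "\<xi> w = 0" unfolding dense r by blast
    qed
    then show "sum_pairing B (x, ?A x) v = 0" by (simp add: sum_pairing_def v)
  qed
  then show ?thesis using dom unfolding is_core_def ext_graph_def by blast
qed

end

theorem theorem3p6:
  fixes \<alpha> :: "real \<Rightarrow> 'e::complex_banach \<Rightarrow> 'e"
    and B :: "'e \<Rightarrow> 'p::complex_banach \<Rightarrow> complex"
    and D :: "'e set"
    and z :: complex
  assumes "isometry_group \<alpha>"
    and "csubspace D"
    and "group_invariant \<alpha> D"
  shows "(norm_continuous_group \<alpha> \<and> D \<subseteq> ext_dom euclidean \<alpha> z \<and> closure D = UNIV
            \<longrightarrow> is_core euclidean euclidean \<alpha> z D) \<and>
         (is_predual B \<and> weak_star_continuous_group B \<alpha> \<and>
          D \<subseteq> ext_dom (weak_star B) \<alpha> z \<and> weak_star B closure_of D = UNIV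
            \<longrightarrow> is_core (weak_star B) (weak_star (sum_pairing B)) \<alpha> z D)"
  using is_core_norm_dense[OF assms] predual.is_core_weak_star_dense[OF predual.intro assms] by blast

end
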